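(* Let $f$ be a transcendental entire function on $\mathbb{C}_p$. Then the set $\{a\in\mathbb{C}_p : f(x)-ax \text{ is not prime}\}$ is at most countable.
   Context: $p$ is a prime number and $\mathbb{C}_p$ is the completion of an algebraic closure of the field $\mathbb{Q}_p$ of $p$-adic numbers, with the usual $p$-adic absolute value. $\mathcal{A}(\mathbb{C}_p)$ is the algebra of entire functions on $\mathbb{C}_p$ (power series over $\mathbb{C}_p$ converging on all of $\mathbb{C}_p$), and $\mathcal{M}(\mathbb{C}_p)$, the field of meromorphic functions in $\mathbb{C}_p$, is its field of fractions. An entire function is transcendental if it is not a polynomial. A linear rational function is one of the form $(ax+b)/(cx+d)$ with $ad-bc\neq0$. A function $F\in\mathcal{M}(\mathbb{C}_p)$ is prime if every factorization $F=f\circ g$ with $f,g\in\mathcal{M}(\mathbb{C}_p)$ implies that $f$ or $g$ is a linear rational function. *)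

theory Defs
  imports "HOL-Analysis.Analysis" "HOL-Computational_Algebra.Computational_Algebra"
begin

section \<open>The field of complex p-adic numbers\<close>

text \<open>
  The library's constant \<^const>\<open>norm\<close> is tied to real vector spaces, so it does not apply here.
  That \<open>absval\<close> is nonnegative and vanishes only at \<open>0\<close> follows from the metric space axioms.
\<close>

class nonarch_field = field_char_0 + metric_space +
  fixes absval :: "'a \<Rightarrow> real"
  assumes dist_absval: "dist x y = absval (x - y)"
    and absval_mult: "absval (x * y) = absval x * absval y"
    and absval_add: "absval (x + y) \<le> max (absval x) (absval y)"

definition padic_abs :: "nat \<Rightarrow> rat \<Rightarrow> real" where
  "padic_abs p x = (if x = 0 then 0 else
     real p powi (int (multiplicity (int p) (snd (quotient_of x)))
                  - int (multiplicity (int p) (fst (quotient_of x)))))"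

definition is_subfield :: "'a::field set \<Rightarrow> bool" where
  "is_subfield L \<longleftrightarrow> 0 \<in> L \<and> 1 \<in> L \<and>
     (\<forall>x\<in>L. \<forall>y\<in>L. x + y \<in> L \<and> x * y \<in> L) \<and> (\<forall>x\<in>L. - x \<in> L \<and> inverse x \<in> L)"

definition algebraic_over :: "'a::field set \<Rightarrow> 'a \<Rightarrow> bool" where
  "algebraic_over F x \<longleftrightarrow> (\<exists>P. P \<noteq> 0 \<and> (\<forall>i. coeff P i \<in> F) \<and> poly P x = 0)"

definition is_algebraic_closure :: "'a::field set \<Rightarrow> 'a set \<Rightarrow> bool" where
  "is_algebraic_closure F L \<longleftrightarrow> is_subfield L \<and> F \<subseteq> L \<and> (\<forall>x\<in>L. algebraic_over F x) \<and>
     (\<forall>P. degree P > 0 \<and> (\<forall>i. coeff P i \<in> L) \<longrightarrow> (\<exists>x\<in>L. poly P x = 0))"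

text \<open>
  \<open>is_Cp p TYPE('a)\<close> says that \<open>'a\<close> is a completion of an algebraic closure of the p-adic numbers;
  this determines \<open>'a\<close> up to isometric isomorphism. Inside the complete field \<open>'a\<close>, the p-adic
  numbers, being the completion of the rationals for the p-adic absolute value, are the topological
  closure of the rationals.
\<close>

definition is_Cp :: "nat \<Rightarrow> 'a::nonarch_field itself \<Rightarrow> bool" where
  "is_Cp p T \<longleftrightarrow>
     (\<forall>q. absval (of_rat q :: 'a) = padic_abs p q) \<and>
     complete (UNIV :: 'a set) \<and>
     (\<exists>L :: 'a set. is_algebraic_closure (closure (range of_rat)) L \<and> closure L = UNIV)"

section \<open>Entire and meromorphic functions\<close>

definition entire :: "('a::nonarch_field \<Rightarrow> 'a) \<Rightarrow> bool" where
  "entire f \<longleftrightarrow> (\<exists>c. \<forall>x. (\<lambda>n. c n * x ^ n) sums f x)"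

definition transcendental_entire :: "('a::nonarch_field \<Rightarrow> 'a) \<Rightarrow> bool" where
  "transcendental_entire f \<longleftrightarrow> entire f \<and> \<not> (\<exists>P. f = poly P)"

text \<open>
  A meromorphic function is represented by the function it induces with values in the projective
  line, \<open>None\<close> being the point at infinity. The value of the fraction \<open>u / v\<close> at a point is defined
  by a punctured limit, so that common zeros of \<open>u\<close> and \<open>v\<close> cancel, and two fractions give the same
  function iff they are equal in the field of fractions of the ring of entire functions.
\<close>

definition fraction_value ::
    "('a::nonarch_field \<Rightarrow> 'a) \<Rightarrow> ('a \<Rightarrow> 'a) \<Rightarrow> 'a \<Rightarrow> 'a option" where
  "fraction_value u v x =
     (if \<exists>y. ((\<lambda>z. u z / v z) \<longlongrightarrow> y) (at x)
      then Some (Lim (at x) (\<lambda>z. u z / v z)) else None)"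

definition meromorphic_Cp :: "('a::nonarch_field \<Rightarrow> 'a option) \<Rightarrow> bool" where
  "meromorphic_Cp F \<longleftrightarrow>
     (\<exists>u v. entire u \<and> entire v \<and> v \<noteq> (\<lambda>_. 0) \<and> F = fraction_value u v)"

definition linear_rational :: "('a::nonarch_field \<Rightarrow> 'a option) \<Rightarrow> bool" where
  "linear_rational F \<longleftrightarrow> (\<exists>a b c d. a * d - b * c \<noteq> 0 \<and>
     (\<forall>x. F x = (if c * x + d = 0 then None else Some ((a * x + b) / (c * x + d)))))"

text \<open>
  \<open>F = f \<circ> g\<close> for meromorphic functions. The values at the poles of \<open>g\<close>, which form a discrete set,
  are not constrained: there the meromorphic function \<open>F\<close> is determined by continuity. If \<open>g\<close> is
  constant and equal to a pole of \<open>f\<close>, then \<open>F\<close> would be constantly infinite, which is not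
  meromorphic.
\<close>

definition is_composition ::
    "('a \<Rightarrow> 'a option) \<Rightarrow> ('a \<Rightarrow> 'a option) \<Rightarrow> ('a \<Rightarrow> 'a option) \<Rightarrow> bool" where
  "is_composition F f g \<longleftrightarrow> (\<forall>x y. g x = Some y \<longrightarrow> F x = f y)"

definition prime_meromorphic :: "('a::nonarch_field \<Rightarrow> 'a option) \<Rightarrow> bool" where
  "prime_meromorphic F \<longleftrightarrow> meromorphic_Cp F \<and>
     (\<forall>f g. meromorphic_Cp f \<and> meromorphic_Cp g \<and> is_composition F f g \<longrightarrow>
        linear_rational f \<or> linear_rational g)"

end

theory Submission imports Defs begin

unbundle no vec_syntax

text \<open>
  Suppose \<open>F(x) = f(x) - a x\<close> is \<open>G \<circ> H\<close> with \<open>G\<close> and \<open>H\<close> entire and \<open>G\<close> not affine. A nonconstant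
  entire function is surjective, so \<open>G'\<close> has a zero \<open>b\<close>, and at every solution \<open>x\<close> of \<open>H(x) = b\<close> the
  line of slope \<open>a\<close> and intercept \<open>G(b)\<close> is tangent to the graph of \<open>f\<close>. All but countably many
  slopes \<open>a\<close> are not the slope of an inflectional tangent or of a line tangent at two points; for
  these \<open>a\<close>, \<open>H - b\<close> has exactly one zero, which is simple, so \<open>H\<close> is affine.

  A meromorphic factorization \<open>F = g \<circ> h\<close> reduces to this case. If \<open>h\<close> has no pole, then \<open>h\<close> and \<open>g\<close>
  are entire. Otherwise \<open>h\<close> takes all large values near a pole, so \<open>g\<close> is bounded near infinity; hence
  \<open>g\<close> has a pole \<open>b\<close>, which \<open>h\<close> omits. Then \<open>H = 1 / (h - b)\<close> is entire and \<open>g\<close> is a polynomial in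
  \<open>1 / (y - b)\<close>.
\<close>

section \<open>Non-archimedean absolute values\<close>

text \<open>Countability rests on separability. The field is not locally compact, so isolated points
  are counted by means of a countable dense set, the roots of rational polynomials. Inflection
  points are isolated; away from them, so are the pairs of contact points of bitangents, in the
  product space: a moving tangent turns about its own point of contact, and one line cannot turn
  about two points at once. Only the dense subfield \<open>L\<close> is known to be algebraically
  closed, so zeros of entire series have to be constructed. The tool is the dominant index of a
  series on a disc, which counts the zeros there: it is stable under small perturbations and drops
  by one when a zero in the disc is divided out. It yields zeros of entire series as limits of roots
  of polynomials over \<open>L\<close>, surjectivity of nonconstant entire functions, and entire
  quotients without Weierstrass products. Surjectivity also takes the place of Picard's theorem: a
  zero-free entire function is constant, so a single simple zero of \<open>H - b\<close> forces
  \<open>H\<close> to be affine.\<close>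

lemma absval_nonneg [simp]: "0 \<le> absval (x::'a::nonarch_field)"
  using dist_absval[of x 0] by (metis diff_zero zero_le_dist)

lemma absval_eq_0_iff [simp]: "absval (x::'a::nonarch_field) = 0 \<longleftrightarrow> x = 0"
  using dist_absval[of x 0] by (metis diff_zero dist_eq_0_iff)

lemma absval_0 [simp]: "absval (0::'a::nonarch_field) = 0"
  by simp

lemma absval_pos [simp]: "0 < absval (x::'a::nonarch_field) \<longleftrightarrow> x \<noteq> 0"
  using absval_nonneg[of x] absval_eq_0_iff[of x] by linarith

lemma absval_1 [simp]: "absval (1::'a::nonarch_field) = 1"
  using absval_mult[of "1::'a" 1] by simp

lemma absval_minus_1: "absval (- 1::'a::nonarch_field) = 1"
proof -
  have "absval (- 1::'a) ^ 2 = 1"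
    using absval_mult[of "-1::'a" "-1"] by (simp add: power2_eq_square)
  thus ?thesis using absval_nonneg[of "-1::'a"] by (simp add: power2_eq_1_iff)
qed

lemma absval_minus [simp]: "absval (- x::'a::nonarch_field) = absval x"
  using absval_mult[of "-1" x] absval_minus_1[where 'a='a] by simp

lemma absval_minus_commute: "absval (x - y::'a::nonarch_field) = absval (y - x)"
  using absval_minus[of "x - y"] by simp

lemma absval_diff: "absval (x - y::'a::nonarch_field) \<le> max (absval x) (absval y)"
  using absval_add[of x "- y"] by simp

lemma absval_inverse [simp]: "absval (inverse x::'a::nonarch_field) = inverse (absval x)"
proof (cases "x = 0")
  case False
  hence "absval x * absval (inverse x) = 1" by (simp flip: absval_mult)
  thus ?thesis using False by (simp add: field_simps)
qed simp

lemma absval_divide: "absval (x / y::'a::nonarch_field) = absval x / absval y"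
  by (simp add: divide_inverse absval_mult)

lemma absval_power: "absval (x ^ n::'a::nonarch_field) = absval x ^ n"
  by (induction n) (simp_all add: absval_mult)

lemma absval_add_eq:
  assumes "absval (x::'a::nonarch_field) < absval y"
  shows "absval (x + y) = absval y"
  using absval_add[of x y] absval_diff[of "x + y" x] assms by auto

lemma absval_sub_eq:
  assumes "absval (y - x::'a::nonarch_field) < absval x"
  shows "absval y = absval x"
  using absval_add_eq[OF assms] by simp

lemma absval_add_le:
  "absval (x::'a::nonarch_field) \<le> B \<Longrightarrow> absval y \<le> B \<Longrightarrow> absval (x + y) \<le> B"
  using absval_add[of x y] by auto

lemma absval_diff_le:
  "absval (x::'a::nonarch_field) \<le> B \<Longrightarrow> absval y \<le> B \<Longrightarrow> absval (x - y) \<le> B"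
  using absval_diff[of x y] by auto

lemma absval_add_less:
  "absval (x::'a::nonarch_field) < B \<Longrightarrow> absval y < B \<Longrightarrow> absval (x + y) < B"
  using absval_add[of x y] by auto

lemma absval_diff_less:
  "absval (x::'a::nonarch_field) < B \<Longrightarrow> absval y < B \<Longrightarrow> absval (x - y) < B"
  using absval_diff[of x y] by auto

lemma absval_sum_le:
  assumes "\<And>i. i \<in> A \<Longrightarrow> absval (f i::'a::nonarch_field) \<le> B" and "0 \<le> B"
  shows "absval (sum f A) \<le> B"
  using assms by (induction A rule: infinite_finite_induct) (auto intro: absval_add_le)

lemma absval_of_nat_le: "absval (of_nat n::'a::nonarch_field) \<le> 1"
  by (induction n) (auto intro: absval_add_le)

lemma tendsto_absval_iff:
  "(f \<longlongrightarrow> (l::'a::nonarch_field)) F \<longleftrightarrow> ((\<lambda>x. absval (f x - l)) \<longlongrightarrow> 0) F"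
  by (subst tendsto_dist_iff) (simp add: dist_absval)

section \<open>Continuity of the field operations\<close>

instance nonarch_field \<subseteq> topological_ab_group_add
proof
  fix a b :: 'a
  show "((\<lambda>x. fst x + snd x) \<longlongrightarrow> a + b) (nhds a \<times>\<^sub>F nhds b)"
    unfolding tendsto_iff
  proof (intro allI impI)
    fix e :: real assume e: "0 < e"
    have "eventually (\<lambda>x. dist x a < e) (nhds a)" "eventually (\<lambda>x. dist x b < e) (nhds b)"
      using e by (auto simp: eventually_nhds_metric)
    hence "eventually (\<lambda>x. dist (fst x) a < e \<and> dist (snd x) b < e) (nhds a \<times>\<^sub>F nhds b)"
      by (auto simp: eventually_prod_filter)
    thus "eventually (\<lambda>x. dist (fst x + snd x) (a + b) < e) (nhds a \<times>\<^sub>F nhds b)"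
    proof eventually_elim
      case (elim x)
      thus ?case
        using absval_add_less[of "fst x - a" e "snd x - b"] by (simp add: dist_absval algebra_simps)
    qed
  qed
  show "(uminus \<longlongrightarrow> - a) (nhds a)"
    unfolding tendsto_iff
  proof (intro allI impI)
    fix e :: real assume e: "0 < e"
    have "eventually (\<lambda>x. dist x a < e) (nhds a)"
      using e by (auto simp: eventually_nhds_metric)
    thus "eventually (\<lambda>x. dist (- x) (- a) < e) (nhds a)"
      by eventually_elim (metis dist_absval absval_minus minus_diff_minus)
  qed
qed

instance nonarch_field \<subseteq> topological_semigroup_mult
proof
  fix a b :: 'a
  have "((\<lambda>x. absval (fst x - a)) \<longlongrightarrow> 0) (nhds a \<times>\<^sub>F nhds b)"
    "((\<lambda>x. absval (snd x - b)) \<longlongrightarrow> 0) (nhds a \<times>\<^sub>F nhds b)"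
    using filterlim_fst[of "nhds a" "nhds b"] filterlim_snd[of "nhds b" "nhds a"]
    by (simp_all flip: tendsto_absval_iff)
  note lims = this
  define h where "h x = absval (fst x - a) * absval (snd x - b) + absval (fst x - a) * absval b
      + absval a * absval (snd x - b)" for x :: "'a \<times> 'a"
  have "(h \<longlongrightarrow> 0 * 0 + 0 * absval b + absval a * 0) (nhds a \<times>\<^sub>F nhds b)"
    unfolding h_def by (intro tendsto_add tendsto_mult tendsto_const lims)
  hence h: "(h \<longlongrightarrow> 0) (nhds a \<times>\<^sub>F nhds b)" by simp
  have le: "absval (fst x * snd x - a * b) \<le> h x" for x :: "'a \<times> 'a"
  proof -
    have "fst x * snd x - a * b = (fst x - a) * (snd x - b) + (fst x - a) * b + a * (snd x - b)"
      by (simp add: algebra_simps)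
    also have "absval \<dots> \<le> h x"
      unfolding h_def absval_mult[symmetric]
      using absval_nonneg[of "(fst x - a) * (snd x - b)"] absval_nonneg[of "(fst x - a) * b"]
        absval_nonneg[of "a * (snd x - b)"]
      by (intro absval_add_le) linarith+
    finally show ?thesis .
  qed
  have "((\<lambda>x. absval (fst x * snd x - a * b)) \<longlongrightarrow> 0) (nhds a \<times>\<^sub>F nhds b)"
    by (rule tendsto_sandwich[OF _ _ tendsto_const h]) (simp_all add: le)
  thus "((\<lambda>x. fst x * snd x) \<longlongrightarrow> a * b) (nhds a \<times>\<^sub>F nhds b)"
    by (rule iffD2[OF tendsto_absval_iff])
qed

lemma tendsto_inverse_nonarch:
  assumes f: "(f \<longlongrightarrow> (l::'a::nonarch_field)) F" and l: "l \<noteq> 0"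
  shows "((\<lambda>x. inverse (f x)) \<longlongrightarrow> inverse l) F"
proof -
  have lim: "((\<lambda>x. absval (f x - l)) \<longlongrightarrow> 0) F" using f by (simp add: tendsto_absval_iff)
  hence "eventually (\<lambda>x. absval (f x - l) < absval l) F"
    using l by (intro order_tendstoD) auto
  \<comment> \<open>Once \<open>f x\<close> is nearer to \<open>l\<close> than
    \<open>absval l\<close>, it has the same absolute value as \<open>l\<close>. The usual estimate
    for a difference of inverses is then an equality with denominator
    \<open>absval l ^ 2\<close>.\<close>
  hence "eventually (\<lambda>x. absval (f x - l) / absval l ^ 2 = absval (inverse (f x) - inverse l)) F"
  proof eventually_elim
    case (elim x)
    hence a: "absval (f x) = absval l" by (rule absval_sub_eq)
    hence "f x \<noteq> 0" using l by auto
    hence "inverse (f x) - inverse l = (l - f x) * inverse (f x) * inverse l"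
      using l by (simp add: field_simps)
    thus ?case using a
      by (simp only: absval_mult absval_inverse absval_minus_commute[of l])
        (simp add: power2_eq_square divide_inverse)
  qed
  moreover have "((\<lambda>x. absval (f x - l) / absval l ^ 2) \<longlongrightarrow> 0 / absval l ^ 2) F"
    using l by (intro tendsto_intros lim) auto
  ultimately have "((\<lambda>x. absval (inverse (f x) - inverse l)) \<longlongrightarrow> 0) F"
    by (simp add: tendsto_cong)
  thus ?thesis by (rule iffD2[OF tendsto_absval_iff])
qed

lemma tendsto_divide_nonarch:
  assumes "(f \<longlongrightarrow> (l::'a::nonarch_field)) F" "(g \<longlongrightarrow> m) F" "m \<noteq> 0"
  shows "((\<lambda>x. f x / g x) \<longlongrightarrow> l / m) F"
  using assms by (auto simp: divide_inverse intro!: tendsto_mult tendsto_inverse_nonarch)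

lemma tendsto_absval:
  assumes "(f \<longlongrightarrow> (l::'a::nonarch_field)) F"
  shows "((\<lambda>x. absval (f x)) \<longlongrightarrow> absval l) F"
  using tendsto_dist[OF assms tendsto_const[of 0]] by (simp add: dist_absval)

lemma tendsto_imp_eventually_nz:
  assumes "(f \<longlongrightarrow> (l::'a::nonarch_field)) F" "l \<noteq> 0"
  shows "eventually (\<lambda>x. f x \<noteq> 0) F"
proof -
  have "eventually (\<lambda>x. 0 < absval (f x)) F"
    using order_tendstoD(1)[OF tendsto_absval[OF assms(1)], of 0] assms(2) by simp
  thus ?thesis by simp
qed

lemma absval_lim_le:
  assumes "f \<longlonglongrightarrow> (l::'a::nonarch_field)" "\<And>n. n \<ge> m \<Longrightarrow> absval (f n) \<le> B"
  shows "absval l \<le> B"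
  using LIMSEQ_le_const2[OF tendsto_absval[OF assms(1)]] assms(2) by blast

text \<open>The properties of the p-adic complex numbers on which the function theory is built. The
  prime enters through \<open>nontrivial\<close>, since p has absolute value 1/p. Algebraic
  closedness is a property of \<open>L\<close> alone here; zeros in the whole field are obtained in
  \<open>root_in_disc\<close>.\<close>

locale dense_alg_closed =
  fixes L :: "'a::nonarch_field set"
  assumes complete: "complete (UNIV :: 'a set)"
    and nontrivial: "\<exists>x::'a. x \<noteq> 0 \<and> absval x < 1"
    and subfield: "is_subfield L"
    and dense: "closure L = UNIV"
    and root_ex: "degree P > 0 \<Longrightarrow> (\<And>i. coeff P i \<in> L) \<Longrightarrow> \<exists>x\<in>L. poly P x = 0"
begin

lemma L_simps: "0 \<in> L" "1 \<in> L" "x \<in> L \<Longrightarrow> y \<in> L \<Longrightarrow> x + y \<in> L"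
  "x \<in> L \<Longrightarrow> y \<in> L \<Longrightarrow> x * y \<in> L" "x \<in> L \<Longrightarrow> - x \<in> L" 
  using subfield by (auto simp: is_subfield_def)

lemma small_element:
  assumes e: "e > 0"
  shows "\<exists>x::'a. x \<noteq> 0 \<and> absval x < e"
proof -
  obtain x :: 'a where x: "x \<noteq> 0" "absval x < 1" using nontrivial by blast
  obtain n where "absval x ^ n < e" using real_arch_pow_inv[OF e x(2)] by blast
  thus ?thesis using x by (intro exI[of _ "x ^ n"]) (auto simp: absval_power)
qed

lemma large_element: "\<exists>x::'a. absval x > B"
proof -
  obtain x :: 'a where x: "x \<noteq> 0" "absval x < inverse (max B 1)"
    using small_element[of "inverse (max B 1)"] by (auto simp: less_max_iff_disj)
  have "inverse (inverse (max B 1)) < inverse (absval x)"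
    by (rule less_imp_inverse_less) (use x in auto)
  hence "B < absval (inverse x)" by simp
  thus ?thesis by blast
qed

text \<open>Small nonzero elements exist, so no point is isolated. This is what makes the punctured
  limits in \<open>fraction_value\<close> unique.\<close>

lemma at_neq_bot [simp]: "at (x::'a) \<noteq> bot"
proof -
  have "\<exists>y. y \<noteq> x \<and> dist y x < e" if e: "e > 0" for e :: real
  proof -
    obtain d :: 'a where "d \<noteq> 0" "absval d < e" using small_element[OF e] by blast
    thus ?thesis by (intro exI[of _ "x + d"]) (auto simp: dist_absval)
  qed
  thus ?thesis by (auto simp: trivial_limit_def eventually_at)
qed

text \<open>By the ultrametric inequality a block of terms is no larger than its largest term, so
  null sequences have Cauchy partial sums.\<close>

lemma summable_nonarch:
  assumes "f \<longlonglongrightarrow> (0::'a)"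
  shows "summable f"
proof -
  have "Cauchy (\<lambda>n. \<Sum>i<n. f i)"
    unfolding Cauchy_def
  proof (intro allI impI)
    fix e :: real assume e: "0 < e"
    have "((\<lambda>n. absval (f n)) \<longlonglongrightarrow> 0)" using assms by (simp add: tendsto_absval_iff)
    \<comment> \<open>Half of \<open>e\<close>, because \<open>absval_sum_le\<close> returns a weak
      inequality and a strict one is wanted.\<close>
    hence "eventually (\<lambda>n. absval (f n) < e/2) sequentially"
      using order_tendstoD(2)[of _ 0 _ "e/2"] e by simp
    then obtain N where N: "\<And>n. n \<ge> N \<Longrightarrow> absval (f n) < e/2"
      by (auto simp: eventually_sequentially)
    have *: "absval ((\<Sum>i<n. f i) - (\<Sum>i<N. f i)) < e" if "n \<ge> N" for n
    proof -
      have "{..<n} = {..<N} \<union> {N..<n}" using that by auto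
      hence "(\<Sum>i<n. f i) - (\<Sum>i<N. f i) = (\<Sum>i\<in>{N..<n}. f i)"
        by (simp add: sum.union_disjoint ivl_disj_int)
      moreover have "absval (\<Sum>i\<in>{N..<n}. f i) \<le> e/2"
        using N e by (intro absval_sum_le) (auto simp: less_imp_le)
      ultimately show ?thesis using e by simp
    qed
    show "\<exists>M. \<forall>m\<ge>M. \<forall>n\<ge>M. dist (\<Sum>i<m. f i) (\<Sum>i<n. f i) < e"
    proof (intro exI[of _ N] allI impI)
      fix m n assume "m \<ge> N" "n \<ge> N"
      from absval_diff_less[OF *[OF this(1)] *[OF this(2)]]
      show "dist (\<Sum>i<m. f i) (\<Sum>i<n. f i) < e" by (simp add: dist_absval)
    qed
  qed
  hence "convergent (\<lambda>n. \<Sum>i<n. f i)"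
    using complete by (auto simp: complete_def convergent_def)
  thus ?thesis by (simp add: summable_iff_convergent)
qed

lemma absval_suminf_le:
  assumes "summable (f :: nat \<Rightarrow> 'a)" "\<And>n. absval (f n) \<le> B"
  shows "absval (suminf f) \<le> B"
proof (rule absval_lim_le)
  show "(\<lambda>n. \<Sum>i<n. f i) \<longlonglongrightarrow> suminf f" using assms(1) summable_LIMSEQ by blast
  have "0 \<le> B" using assms(2)[of 0] absval_nonneg[of "f 0"] by linarith
  thus "absval (\<Sum>i<n. f i) \<le> B" if "n \<ge> 0" for n
    using assms(2) by (intro absval_sum_le) auto
qed

end

section \<open>Entire power series\<close>

text \<open>Infinite radius of convergence, phrased as boundedness at every radius instead of
  convergence to 0: bounds pass easily to sums, products and quotients, and convergence is recovered
  by enlarging the radius. Formal series supply the ring structure, the absence of zero divisors and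
  the derivative.\<close>

definition entire_fps :: "'a::nonarch_field fps \<Rightarrow> bool" where
  "entire_fps U \<longleftrightarrow> (\<forall>r>0. \<exists>B. \<forall>n. absval (U $ n) * r ^ n \<le> B)"

definition ev :: "'a::nonarch_field fps \<Rightarrow> 'a \<Rightarrow> 'a" where
  "ev U x = (\<Sum>n. U $ n * x ^ n)"

lemma entire_fpsD:
  assumes "entire_fps U" "0 < r"
  obtains B where "0 < B" "\<And>n. absval (U $ n) * r ^ n \<le> B"
proof -
  obtain B where B: "\<And>n. absval (U $ n) * r ^ n \<le> B"
    using assms unfolding entire_fps_def by blast
  show thesis by (rule that[of "max B 1"]) (auto simp: B le_max_iff_disj)
qed

text \<open>A bound at one radius is a bound at all smaller ones. In divisions by
  \<open>X - w\<close> the estimate is available for radii from \<open>absval w\<close> on.\<close>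

lemma entire_fpsI_ge:
  assumes "\<And>r. r \<ge> R \<Longrightarrow> 0 < r \<Longrightarrow> \<exists>B. \<forall>n. absval (U $ n) * r ^ n \<le> B"
  shows "entire_fps U"
  unfolding entire_fps_def
proof (intro allI impI)
  fix r :: real assume r: "r > 0"
  obtain B where B: "\<And>n. absval (U $ n) * (max r R) ^ n \<le> B"
    using assms[of "max r R"] r by (auto simp: less_max_iff_disj)
  have "absval (U $ n) * r ^ n \<le> B" for n
    using r by (intro order.trans[OF mult_left_mono B] power_mono) auto
  thus "\<exists>B. \<forall>n. absval (U $ n) * r ^ n \<le> B" by blast
qed

lemma entire_fps_coeff_tendsto:
  assumes "entire_fps U" "0 < r"
  shows "(\<lambda>n. absval (U $ n) * r ^ n) \<longlonglongrightarrow> 0"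
proof -
  \<comment> \<open>Boundedness at radius \<open>2 * r\<close> leaves a factor
    \<open>(1/2) ^ n\<close> at radius \<open>r\<close>.\<close>
  obtain B where B: "\<And>n. absval (U $ n) * (2 * r) ^ n \<le> B"
    using assms unfolding entire_fps_def by (metis mult_pos_pos zero_less_numeral)
  have lim: "(\<lambda>n. B * (1/2) ^ n) \<longlonglongrightarrow> B * 0"
    by (intro tendsto_mult tendsto_const LIMSEQ_realpow_zero) auto
  hence lim': "(\<lambda>n. B * (1/2) ^ n) \<longlonglongrightarrow> 0" by simp
  have "absval (U $ n) * r ^ n \<le> B * (1/2) ^ n" for n
    using B[of n] unfolding power_mult_distrib power_one_over
    by (simp add: pos_le_divide_eq mult_ac)
  thus ?thesis
    by (intro tendsto_sandwich[OF _ _ tendsto_const lim'] always_eventually allI)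
      (use assms(2) in auto)
qed

section \<open>Closure properties of entire series\<close>

lemma entire_fps_of_poly [simp]: "entire_fps (fps_of_poly P)"
  unfolding entire_fps_def
proof (intro allI impI exI)
  fix r :: real and n assume r: "r > 0"
  show "absval (fps_of_poly P $ n) * r ^ n \<le> (\<Sum>i\<le>degree P. absval (coeff P i) * r ^ i)"
  proof (cases "n \<le> degree P")
    case True
    thus ?thesis using r
      by (auto intro!: member_le_sum[of n _ "\<lambda>i. absval (coeff P i) * r ^ i"])
  next
    case False
    thus ?thesis using r by (auto simp: coeff_eq_0 intro!: sum_nonneg)
  qed
qed

lemma entire_fps_const [simp]: "entire_fps (fps_const c)"
  using entire_fps_of_poly[of "[:c:]"] by (simp add: fps_of_poly_const)

lemma entire_fps_X [simp]: "entire_fps fps_X"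
  using entire_fps_of_poly[of "[:0, 1:]"] by simp

lemma entire_fps_0 [simp]: "entire_fps 0" and entire_fps_1 [simp]: "entire_fps 1"
  using entire_fps_of_poly[of 0] entire_fps_of_poly[of 1] by simp_all

lemma entire_fps_add [simp]:
  assumes "entire_fps U" "entire_fps V"
  shows "entire_fps (U + V)"
  unfolding entire_fps_def
proof (intro allI impI)
  fix r :: real assume r: "r > 0"
  obtain A where A: "\<And>n. absval (U $ n) * r ^ n \<le> A"
    using entire_fpsD[OF assms(1) r] by blast
  obtain B where B: "\<And>n. absval (V $ n) * r ^ n \<le> B"
    using entire_fpsD[OF assms(2) r] by blast
  have "absval ((U + V) $ n) * r ^ n \<le> max A B" for n
  proof -
    have "absval ((U + V) $ n) \<le> max (absval (U $ n)) (absval (V $ n))"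
      using absval_add[of "U $ n" "V $ n"] by simp
    hence "absval ((U + V) $ n) * r ^ n \<le> max (absval (U $ n)) (absval (V $ n)) * r ^ n"
      using r by (intro mult_right_mono) auto
    also have "\<dots> \<le> max A B" using A[of n] B[of n] by (auto simp: max_def)
    finally show ?thesis .
  qed
  thus "\<exists>B. \<forall>n. absval ((U + V) $ n) * r ^ n \<le> B" by blast
qed

lemma entire_fps_mult [simp]:
  assumes "entire_fps U" "entire_fps V"
  shows "entire_fps (U * V)"
  unfolding entire_fps_def
proof (intro allI impI)
  fix r :: real assume r: "r > 0"
  obtain A where A: "0 < A" "\<And>n. absval (U $ n) * r ^ n \<le> A"
    using entire_fpsD[OF assms(1) r] by blast
  obtain B where B: "0 < B" "\<And>n. absval (V $ n) * r ^ n \<le> B"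
    using entire_fpsD[OF assms(2) r] by blast
  have "absval ((U * V) $ n) \<le> A * B / r ^ n" for n
    unfolding fps_mult_nth
  proof (rule absval_sum_le)
    fix i assume i: "i \<in> {0..n}"
    have "absval (U $ i * V $ (n - i)) * r ^ n
          = (absval (U $ i) * r ^ i) * (absval (V $ (n - i)) * r ^ (n - i))"
      using i by (simp add: absval_mult flip: power_add)
    also have "\<dots> \<le> A * B"
      using A B r by (intro mult_mono) auto
    finally show "absval (U $ i * V $ (n - i)) \<le> A * B / r ^ n"
      using r by (simp add: field_simps)
  qed (use A B r in auto)
  hence "absval ((U * V) $ n) * r ^ n \<le> A * B" for n
    using r by (simp add: field_simps)
  thus "\<exists>B. \<forall>n. absval ((U * V) $ n) * r ^ n \<le> B" by blast
qed

lemma entire_fps_uminus [simp]: "entire_fps U \<Longrightarrow> entire_fps (- U)"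
  by (simp add: entire_fps_def)

lemma entire_fps_diff [simp]: "entire_fps U \<Longrightarrow> entire_fps V \<Longrightarrow> entire_fps (U - V)"
  using entire_fps_add[of U "- V"] by simp

lemma entire_fps_power [simp]: "entire_fps U \<Longrightarrow> entire_fps (U ^ n)"
  by (induction n) auto

text \<open>Integers have absolute value at most 1, so the factors produced by differentiation never
  enlarge a coefficient.\<close>

lemma entire_fps_deriv [simp]:
  assumes "entire_fps U"
  shows "entire_fps (fps_deriv U)"
  unfolding entire_fps_def
proof (intro allI impI)
  fix r :: real assume r: "r > 0"
  obtain A where A: "0 < A" "\<And>n. absval (U $ n) * r ^ n \<le> A"
    using entire_fpsD[OF assms r] by blast
  have "absval (fps_deriv U $ n) * r ^ n \<le> A / r" for n
  proof -
    have "absval (fps_deriv U $ n) \<le> 1 * absval (U $ Suc n)"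
      using absval_of_nat_le[of "Suc n", where 'a='a]
      unfolding fps_deriv_nth absval_mult Suc_eq_plus1
      by (intro mult_right_mono) (simp_all del: of_nat_add of_nat_Suc)
    hence "absval (fps_deriv U $ n) * r ^ n \<le> absval (U $ Suc n) * r ^ n"
      using r by simp
    also have "\<dots> \<le> A / r" using A(2)[of "Suc n"] r by (simp add: field_simps)
    finally show ?thesis .
  qed
  thus "\<exists>B. \<forall>n. absval (fps_deriv U $ n) * r ^ n \<le> B" by blast
qed

section \<open>Evaluation of entire series\<close>

context dense_alg_closed
begin

lemma tendsto_zero_absvalI:
  "((\<lambda>n. absval (f n)) \<longlonglongrightarrow> 0) \<Longrightarrow> f \<longlonglongrightarrow> (0::'a)"
  by (simp add: tendsto_absval_iff)

lemma ev_sums: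
  assumes "entire_fps (U::'a fps)"
  shows "(\<lambda>n. U $ n * x ^ n) sums ev U x"
proof -
  have "(\<lambda>n. absval (U $ n) * (absval x + 1) ^ n) \<longlonglongrightarrow> 0"
    by (rule entire_fps_coeff_tendsto[OF assms]) (simp add: add_nonneg_pos)
  hence "(\<lambda>n. absval (U $ n * x ^ n)) \<longlonglongrightarrow> 0"
    by (rule tendsto_sandwich[OF always_eventually always_eventually tendsto_const, rotated 2])
      (auto simp: absval_mult absval_power intro!: mult_left_mono power_mono)
  from summable_nonarch[OF tendsto_zero_absvalI[OF this]]
  show ?thesis unfolding ev_def by (rule summable_sums)
qed

text \<open>Convergence at a point of absolute value above \<open>r\<close> bounds the terms at
  radius \<open>r\<close>, and such points exist for every \<open>r\<close>.\<close>

lemma sums_entire_fps: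
  assumes "\<And>x::'a. summable (\<lambda>n. c n * x ^ n)"
  shows "entire_fps (Abs_fps c)"
  unfolding entire_fps_def
proof (intro allI impI)
  fix r :: real assume r: "0 < r"
  obtain x :: 'a where x: "absval x > r" using large_element by blast
  have "(\<lambda>n. \<Sum>i<n. c i * x ^ i) \<longlonglongrightarrow> (\<Sum>i. c i * x ^ i)"
    using assms[of x] by (rule summable_LIMSEQ)
  from tendsto_diff[OF LIMSEQ_Suc[OF this] this]
  have "(\<lambda>n. absval (c n * x ^ n)) \<longlonglongrightarrow> 0"
    by (simp add: tendsto_absval_iff)
  then obtain B where B: "\<And>n. absval (c n * x ^ n) \<le> B"
    using convergent_imp_Bseq[of "\<lambda>n. absval (c n * x ^ n)"]
    by (auto simp: convergent_def Bseq_def)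
  have "absval (c n) * r ^ n \<le> B" for n
  proof -
    have "absval (c n) * r ^ n \<le> absval (c n) * absval x ^ n"
      using x r by (intro mult_left_mono power_mono) auto
    thus ?thesis using B[of n] by (simp add: absval_mult absval_power)
  qed
  thus "\<exists>B. \<forall>n. absval (Abs_fps c $ n) * r ^ n \<le> B" by auto
qed

lemma entire_iff: "entire (f::'a \<Rightarrow> 'a) \<longleftrightarrow> (\<exists>U. entire_fps U \<and> f = ev U)"
proof
  assume "entire f"
  then obtain c where c: "\<And>x. (\<lambda>n. c n * x ^ n) sums f x" unfolding entire_def by blast
  have "entire_fps (Abs_fps c)" using c by (intro sums_entire_fps) (auto simp: sums_iff)
  moreover have "f = ev (Abs_fps c)" using c by (auto simp: ev_def sums_iff)
  ultimately show "\<exists>U. entire_fps U \<and> f = ev U" by blast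
next
  assume "\<exists>U. entire_fps U \<and> f = ev U"
  thus "entire f" unfolding entire_def using ev_sums by blast
qed

lemma ev_le:
  assumes "entire_fps (U::'a fps)" "absval x \<le> r" "\<And>n. absval (U $ n) * r ^ n \<le> B"
  shows "absval (ev U x) \<le> B"
  unfolding ev_def
proof (rule absval_suminf_le)
  show "summable (\<lambda>n. U $ n * x ^ n)" using ev_sums[OF assms(1)] sums_summable by blast
  fix n
  have "absval (U $ n * x ^ n) \<le> absval (U $ n) * r ^ n"
    using assms(2) by (auto simp: absval_mult absval_power intro!: mult_left_mono power_mono)
  thus "absval (U $ n * x ^ n) \<le> B" using assms(3)[of n] by linarith
qed

lemma ev_of_poly [simp]: "ev (fps_of_poly P) x = poly P (x::'a)"
proof -
  have "(\<lambda>n. fps_of_poly P $ n * x ^ n) sums (\<Sum>n\<in>{..degree P}. fps_of_poly P $ n * x ^ n)"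
    by (rule sums_finite) (auto simp: coeff_eq_0)
  thus ?thesis unfolding ev_def by (simp add: sums_iff poly_altdef)
qed

lemma ev_const [simp]: "ev (fps_const c) (x::'a) = c"
  using ev_of_poly[of "[:c:]" x] by (simp add: fps_of_poly_const)

lemma ev_X [simp]: "ev fps_X (x::'a) = x"
  using ev_of_poly[of "[:0,1:]" x] by simp

lemma ev_0 [simp]: "ev 0 (x::'a) = 0" and ev_1 [simp]: "ev 1 (x::'a) = 1"
  using ev_of_poly[of 0 x] ev_of_poly[of 1 x] by simp_all

lemma ev_add [simp]:
  assumes "entire_fps U" "entire_fps V"
  shows "ev (U + V) (x::'a) = ev U x + ev V x"
  using sums_add[OF ev_sums[OF assms(1), of x] ev_sums[OF assms(2), of x]]
  by (simp add: ev_def sums_iff distrib_right)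

text \<open>The partial sum of the Cauchy product runs over the triangle \<open>i + j < n\<close>,
  the product of the partial sums over the square. For \<open>n \<ge> 2 * N\<close> every remaining
  pair has an index at least \<open>N\<close>, so its term is small, and the ultrametric inequality
  bounds their sum without absolute convergence.\<close>

lemma ev_mult [simp]:
  assumes "entire_fps U" "entire_fps V"
  shows "ev (U * V) (x::'a) = ev U x * ev V x"
proof -
  \<comment> \<open>One more than \<open>absval x\<close>, so that the radius is positive even at
    \<open>x = 0\<close>.\<close>
  define r where "r = absval x + 1"
  have r: "r > 0" by (simp add: r_def add_nonneg_pos)
  let ?u = "\<lambda>n. U $ n * x ^ n" and ?v = "\<lambda>n. V $ n * x ^ n"
  let ?a = "\<lambda>n. absval (U $ n) * r ^ n" and ?b = "\<lambda>n. absval (V $ n) * r ^ n"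
  have ua: "absval (?u n) \<le> ?a n" and vb: "absval (?v n) \<le> ?b n" for n
    by (auto simp: r_def absval_mult absval_power intro!: mult_left_mono power_mono)
  obtain A where A: "0 < A" "\<And>n. ?a n \<le> A" using entire_fpsD[OF assms(1) r] by blast
  obtain B where B: "0 < B" "\<And>n. ?b n \<le> B" using entire_fpsD[OF assms(2) r] by blast
  have "(\<lambda>n. (\<Sum>i<n. (U * V) $ i * x ^ i) - (\<Sum>i<n. ?u i) * (\<Sum>j<n. ?v j)) \<longlonglongrightarrow> 0"
    unfolding tendsto_iff
  proof (intro allI impI)
    fix e :: real assume e: "0 < e"
    have "eventually (\<lambda>n. ?a n < e / 2 / B) sequentially" "eventually (\<lambda>n. ?b n < e / 2 / A) sequentially"
      using entire_fps_coeff_tendsto[OF assms(1) r] entire_fps_coeff_tendsto[OF assms(2) r] e A(1) B(1)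
      by (auto intro!: order_tendstoD(2))
    hence "eventually (\<lambda>n. ?a n < e / 2 / B \<and> ?b n < e / 2 / A) sequentially"
      by eventually_elim auto
    then obtain N where N: "\<And>n. n \<ge> N \<Longrightarrow> ?a n < e / 2 / B" "\<And>n. n \<ge> N \<Longrightarrow> ?b n < e / 2 / A"
      by (auto simp: eventually_sequentially)
    have "dist ((\<Sum>i<n. (U * V) $ i * x ^ i) - (\<Sum>i<n. ?u i) * (\<Sum>j<n. ?v j)) 0 < e"
      if n: "n \<ge> 2 * N" for n
    proof -
      have "(\<Sum>i<n. (U * V) $ i * x ^ i) = (\<Sum>i<n. \<Sum>k\<le>i. ?u k * ?v (i - k))"
      proof (intro sum.cong refl)
        fix i
        have "(U * V) $ i * x ^ i = (\<Sum>k\<le>i. U $ k * V $ (i - k) * x ^ i)"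
          by (simp add: fps_mult_nth sum_distrib_right atLeast0AtMost)
        also have "\<dots> = (\<Sum>k\<le>i. ?u k * ?v (i - k))"
        proof (intro sum.cong refl)
          fix k assume "k \<in> {..i}"
          hence "x ^ i = x ^ k * x ^ (i - k)" by (simp flip: power_add)
          thus "U $ k * V $ (i - k) * x ^ i = ?u k * ?v (i - k)" by (simp add: mult_ac)
        qed
        finally show "(U * V) $ i * x ^ i = (\<Sum>k\<le>i. ?u k * ?v (i - k))" .
      qed
      also have "\<dots> = (\<Sum>(i,j)\<in>{(i,j). i + j < n}. ?u i * ?v j)"
        by (rule sum.triangle_reindex [symmetric])
      finally have 1: "(\<Sum>i<n. (U * V) $ i * x ^ i) = (\<Sum>(i,j)\<in>{(i,j). i + j < n}. ?u i * ?v j)" .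
      have 2: "(\<Sum>i<n. ?u i) * (\<Sum>j<n. ?v j) = (\<Sum>(i,j)\<in>{..<n}\<times>{..<n}. ?u i * ?v j)"
        by (simp add: sum_product sum.cartesian_product)
      have sub: "{(i,j). i + j < n} \<subseteq> {..<n}\<times>{..<n}" by auto
      have "(\<Sum>i<n. ?u i) * (\<Sum>j<n. ?v j) - (\<Sum>i<n. (U * V) $ i * x ^ i)
            = (\<Sum>(i,j)\<in>{..<n}\<times>{..<n} - {(i,j). i + j < n}. ?u i * ?v j)"
        unfolding 1 2 by (subst sum_diff[OF _ sub]) auto
      also have "absval \<dots> \<le> e / 2"
      proof (rule absval_sum_le)
        fix p assume p: "p \<in> {..<n}\<times>{..<n} - {(i,j). i + j < n}"
        obtain i j where ij: "p = (i,j)" by force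
        from p ij n have "i \<ge> N \<or> j \<ge> N" by auto
        hence "?a i * ?b j \<le> e / 2"
        proof
          assume "i \<ge> N"
          hence "?a i * ?b j \<le> e / 2 / B * B"
            using N(1)[of i] B r e by (intro mult_mono) (auto simp: less_imp_le)
          thus ?thesis using B(1) by simp
        next
          assume "j \<ge> N"
          hence "?a i * ?b j \<le> A * (e / 2 / A)"
            using N(2)[of j] A r e by (intro mult_mono) (auto simp: less_imp_le)
          thus ?thesis using A(1) by simp
        qed
        moreover have "absval (?u i * ?v j) \<le> ?a i * ?b j"
          unfolding absval_mult[of "?u i"] using ua[of i] vb[of j] r by (intro mult_mono) auto
        ultimately show "absval (case p of (i, j) \<Rightarrow> ?u i * ?v j) \<le> e / 2"
          using ij by simp
      qed (use e in simp)
      finally show ?thesis using e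
        by (simp add: dist_absval absval_minus_commute[of "sum _ _ * sum _ _"])
    qed
    thus "eventually (\<lambda>n. dist ((\<Sum>i<n. (U * V) $ i * x ^ i) - (\<Sum>i<n. ?u i) * (\<Sum>j<n. ?v j)) 0 < e)
            sequentially"
      by (auto simp: eventually_sequentially)
  qed
  moreover have "(\<lambda>n. (\<Sum>i<n. (U * V) $ i * x ^ i) - (\<Sum>i<n. ?u i) * (\<Sum>j<n. ?v j))
      \<longlonglongrightarrow> ev (U * V) x - ev U x * ev V x"
    using ev_sums[OF entire_fps_mult[OF assms], of x] ev_sums[OF assms(1), of x] ev_sums[OF assms(2), of x]
    unfolding sums_def by (intro tendsto_diff tendsto_mult)
  ultimately have "ev (U * V) x - ev U x * ev V x = 0"
    using LIMSEQ_unique by blast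
  thus ?thesis by simp
qed

lemma ev_uminus [simp]: "entire_fps U \<Longrightarrow> ev (- U) (x::'a) = - ev U x"
  using ev_add[of U "- U" x] by (simp add: eq_neg_iff_add_eq_0 add.commute)

lemma ev_diff [simp]:
  "entire_fps U \<Longrightarrow> entire_fps V \<Longrightarrow> ev (U - V) (x::'a) = ev U x - ev V x"
  using ev_add[of U "- V" x] by simp

lemma ev_power [simp]: "entire_fps U \<Longrightarrow> ev (U ^ n) (x::'a) = ev U x ^ n"
  by (induction n) auto

text \<open>Division by \<open>X - w\<close>: the coefficients of the quotient are the tails
  \<open>U $ (k+1) + U $ (k+2) * w + ...\<close>, as in Horner's scheme. Root factors, continuity
  and Taylor expansions all come from this identity.\<close>

lemma ev_remainder:
  assumes U: "entire_fps (U::'a fps)"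
  obtains Q where "entire_fps Q" "U = fps_const (ev U w) + (fps_X - fps_const w) * Q"
proof -
  define Q where "Q = Abs_fps (\<lambda>k. \<Sum>n. U $ (n + Suc k) * w ^ n)"
  have summ: "summable (\<lambda>n. U $ (n + k) * w ^ n)" for k
  proof (cases "w = 0")
    case True
    have "summable (\<lambda>n. if n = 0 then U $ k else 0)" by (rule summable_single)
    moreover have "(\<lambda>n. U $ (n + k) * w ^ n) = (\<lambda>n. if n = 0 then U $ k else 0)"
      using True by (auto simp: fun_eq_iff power_0_left)
    ultimately show ?thesis by simp
  next
    case False
    have "(\<lambda>n. U $ n * w ^ n) \<longlonglongrightarrow> 0"
    proof (rule tendsto_zero_absvalI)
      show "(\<lambda>n. absval (U $ n * w ^ n)) \<longlonglongrightarrow> 0"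
        using entire_fps_coeff_tendsto[OF U, of "absval w"] False by (simp add: absval_mult absval_power)
    qed
    hence "(\<lambda>n. U $ (n + k) * w ^ (n + k)) \<longlonglongrightarrow> 0" by (rule LIMSEQ_ignore_initial_segment)
    from tendsto_mult_left[OF this, of "inverse (w ^ k)"]
    have "(\<lambda>n. U $ (n + k) * w ^ n) \<longlonglongrightarrow> 0"
      using False by (simp add: power_add field_simps)
    thus ?thesis by (rule summable_nonarch)
  qed
  \<comment> \<open>Horner's recursion: the tail starting at index \<open>k\<close> is
    \<open>U $ k\<close> plus \<open>w\<close> times the next tail. For \<open>k = 0\<close> the
    left side is \<open>ev U w\<close>, the remainder.\<close>
  have step: "(\<Sum>n. U $ (n + k) * w ^ n) = U $ k + w * Q $ k" for k
  proof -
    have s2: "(\<lambda>n. U $ (n + Suc k) * w ^ n) sums (Q $ k)"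
      using summ[of "Suc k"] by (simp add: Q_def summable_sums)
    have "(\<lambda>n. w * (U $ (n + Suc k) * w ^ n)) sums (w * Q $ k)"
      unfolding sums_def sum_distrib_left[symmetric]
      using s2[unfolded sums_def] by (rule tendsto_mult_left)
    hence "(\<lambda>n. U $ (Suc n + k) * w ^ Suc n) sums (w * Q $ k)"
      by (simp add: mult_ac)
    hence "(\<lambda>n. U $ (n + k) * w ^ n) sums (w * Q $ k + U $ (0 + k) * w ^ 0)"
      by (rule sums_Suc)
    thus ?thesis by (simp add: sums_iff add_ac)
  qed
  have eq: "U = fps_const (ev U w) + (fps_X - fps_const w) * Q"
  proof (rule fps_ext)
    fix n
    show "U $ n = (fps_const (ev U w) + (fps_X - fps_const w) * Q) $ n"
      using step[of n] by (cases n) (simp_all add: left_diff_distrib Q_def ev_def)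
  qed
  \<comment> \<open>For \<open>r \<ge> absval w\<close> each power of \<open>w\<close> in a tail is
    bounded by the same power of \<open>r\<close>, so all terms of the tail are at most
    \<open>B / r ^ Suc k\<close>.\<close>
  have "entire_fps Q"
  proof (rule entire_fpsI_ge[of "absval w"])
    fix r :: real assume r: "r \<ge> absval w" "r > 0"
    obtain B where B: "0 < B" "\<And>n. absval (U $ n) * r ^ n \<le> B"
      using entire_fpsD[OF U r(2)] by blast
    have "absval (Q $ k) \<le> B / r ^ Suc k" for k
      unfolding Q_def fps_nth_Abs_fps
    proof (rule absval_suminf_le[OF summ])
      fix n
      have "absval (U $ (n + Suc k) * w ^ n) * r ^ Suc k \<le> absval (U $ (n + Suc k)) * r ^ n * r ^ Suc k"
        unfolding absval_mult absval_power
        using r by (intro mult_right_mono mult_left_mono power_mono) auto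
      also have "\<dots> = absval (U $ (n + Suc k)) * r ^ (n + Suc k)" by (simp add: power_add)
      also have "\<dots> \<le> B" by (rule B)
      finally show "absval (U $ (n + Suc k) * w ^ n) \<le> B / r ^ Suc k"
        using r by (simp add: pos_le_divide_eq)
    qed
    hence "absval (Q $ k) * r ^ k \<le> B / r" for k
      using r by (simp add: field_simps)
    thus "\<exists>B. \<forall>n. absval (Q $ n) * r ^ n \<le> B" by blast
  qed
  thus thesis using that eq by blast
qed

lemma root_factor:
  assumes "entire_fps (U::'a fps)" "ev U w = 0"
  obtains Q where "entire_fps Q" "U = (fps_X - fps_const w) * Q"
  using ev_remainder[OF assms(1), of w] assms(2) by auto

text \<open>The quotient by \<open>X - w\<close> is bounded on the disc of radius
  \<open>absval w + 1\<close>, which gives a Lipschitz estimate near \<open>w\<close>.\<close>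

lemma isCont_ev:
  assumes "entire_fps (U::'a fps)"
  shows "(ev U \<longlongrightarrow> ev U w) (at w)"
proof -
  obtain Q where Q: "entire_fps Q" "U = fps_const (ev U w) + (fps_X - fps_const w) * Q"
    using ev_remainder[OF assms] by blast
  define r where "r = absval w + 1"
  have r: "r > 0" by (simp add: r_def add_nonneg_pos)
  obtain B where B: "0 < B" "\<And>n. absval (Q $ n) * r ^ n \<le> B" using entire_fpsD[OF Q(1) r] by blast
  have ev: "ev U x - ev U w = (x - w) * ev Q x" for x
    using arg_cong[OF Q(2), of "\<lambda>U. ev U x"] Q(1) by simp
  have lim: "((\<lambda>x. absval (x - w)) \<longlongrightarrow> 0) (at w)" 
    using tendsto_ident_at[of w UNIV] by (simp add: tendsto_absval_iff)
  hence "eventually (\<lambda>x. absval (x - w) < 1) (at w)" by (intro order_tendstoD(2)) auto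
  hence le: "eventually (\<lambda>x. absval (ev U x - ev U w) \<le> absval (x - w) * B) (at w)"
  proof eventually_elim
    case (elim x)
    have "absval x \<le> r" using elim absval_add_le[of w r "x - w"] by (simp add: r_def add_increasing)
    from ev_le[OF Q(1) this B(2)] show ?case by (simp add: ev absval_mult mult_left_mono)
  qed
  have "((\<lambda>x. absval (x - w) * B) \<longlongrightarrow> 0 * B) (at w)" by (intro tendsto_mult lim tendsto_const)
  hence lim2: "((\<lambda>x. absval (x - w) * B) \<longlongrightarrow> 0) (at w)" by simp
  have "((\<lambda>x. absval (ev U x - ev U w)) \<longlongrightarrow> 0) (at w)"
    by (rule tendsto_sandwich[OF _ le tendsto_const lim2]) simp
  thus ?thesis by (rule iffD2[OF tendsto_absval_iff])
qed

lemma fps_linear_nth: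
  "((fps_X - fps_const w) * Q) $ n = (case n of 0 \<Rightarrow> - (w * Q $ 0) | Suc m \<Rightarrow> Q $ m - w * Q $ Suc m)"
  for w :: 'a
  by (cases n) (simp_all add: left_diff_distrib)

end

section \<open>Zeros of entire power series\<close>

text \<open>\<open>N\<close> is the last index at which the Gauss norm of \<open>U\<close> on the
  disc of radius \<open>r\<close> is attained, the Weierstrass degree. It equals the number of zeros
  in the closed disc, counted with multiplicity, and serves as induction measure whenever zeros are
  divided out.\<close>

definition dominant :: "real \<Rightarrow> nat \<Rightarrow> 'a::nonarch_field fps \<Rightarrow> bool" where
  "dominant r N U \<longleftrightarrow> U $ N \<noteq> 0 \<and> (\<forall>n. absval (U $ n) * r ^ n \<le> absval (U $ N) * r ^ N) \<and>
     (\<forall>n>N. absval (U $ n) * r ^ n < absval (U $ N) * r ^ N)"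

lemma dominant_unique:
  assumes "dominant r N U" "dominant r M U"
  shows "N = M"
  using assms unfolding dominant_def by (metis linorder_neqE_nat not_less)

lemma dominant_exists:
  assumes "entire_fps U" "U \<noteq> 0" "0 < r"
  obtains N where "dominant r N U"
proof -
  let ?a = "\<lambda>n. absval (U $ n) * r ^ n"
  obtain k where k: "U $ k \<noteq> 0" using assms(2) by (auto simp: fps_eq_iff)
  hence "?a k > 0" using assms(3) by simp
  hence "eventually (\<lambda>n. ?a n < ?a k) sequentially"
    by (intro order_tendstoD(2)[OF entire_fps_coeff_tendsto[OF assms(1,3)]])
  then obtain K where K: "\<And>n. n \<ge> K \<Longrightarrow> ?a n < ?a k" by (auto simp: eventually_sequentially)
  \<comment> \<open>Only the finitely many indices whose term is at least that of a fixed nonzero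
    coefficient can carry the maximum.\<close>
  define A where "A = {n. ?a n \<ge> ?a k}"
  have fin: "finite A" 
  proof (rule finite_subset[of _ "{..K}"])
    show "A \<subseteq> {..K}"
    proof
      fix n assume "n \<in> A"
      hence "\<not> n \<ge> K" using K[of n] by (auto simp: A_def)
      thus "n \<in> {..K}" by simp
    qed
  qed simp
  have kA: "k \<in> A" by (simp add: A_def)
  define M where "M = Max (?a ` A)"
  have M: "?a n \<le> M" if "n \<in> A" for n using that fin by (auto simp: M_def)
  have M': "?a n \<le> M" for n
    using M[of n] M[OF kA] by (cases "n \<in> A") (auto simp: A_def)
  define B where "B = {n\<in>A. ?a n = M}"
  have "M \<in> ?a ` A" unfolding M_def using fin kA by (intro Max_in) auto
  hence "B \<noteq> {}" by (auto simp: B_def)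
  moreover have "finite B" using fin by (simp add: B_def)
  ultimately have NB: "Max B \<in> B" and Nmax: "\<And>n. n \<in> B \<Longrightarrow> n \<le> Max B" by auto
  have eq: "?a (Max B) = M" using NB by (simp add: B_def)
  have "dominant r (Max B) U"
    unfolding dominant_def eq
  proof (intro conjI allI impI M')
    show "U $ Max B \<noteq> 0" using eq M[OF kA] \<open>?a k > 0\<close> by auto
    fix n assume n: "n > Max B"
    hence "n \<notin> B" using Nmax by force
    show "?a n < M"
    proof (cases "n \<in> A")
      case True
      thus ?thesis using \<open>n \<notin> B\<close> M'[of n] by (auto simp: B_def)
    next
      case False
      thus ?thesis using M[OF kA] by (auto simp: A_def)
    qed
  qed
  thus thesis using that by blast
qed

text \<open>The number of zeros in a disc is stable under changes smaller than the Gauss norm. The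
  changes in question are approximations by polynomials over \<open>L\<close> or over the rationals,
  and \<open>T - S / y\<close> in place of \<open>T\<close> near a pole of
  \<open>S / T\<close>.\<close>

lemma dominant_perturb:
  assumes "dominant r N U" "0 < r" "\<And>n. absval (A $ n - U $ n) * r ^ n < absval (U $ N) * r ^ N"
  shows "dominant r N A" "absval (A $ N) = absval (U $ N)"
proof -
  show eq: "absval (A $ N) = absval (U $ N)"
    by (rule absval_sub_eq) (use assms(2) assms(3)[of N] in simp)
  have le: "absval (A $ n) * r ^ n \<le> max (absval (U $ n) * r ^ n) (absval (A $ n - U $ n) * r ^ n)" for n
    using absval_add[of "U $ n" "A $ n - U $ n"] assms(2) by (auto simp: le_max_iff_disj)
  show "dominant r N A"
    unfolding dominant_def eq
  proof (intro conjI allI impI)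
    show "A $ N \<noteq> 0" using eq assms(1) unfolding dominant_def by (metis absval_eq_0_iff)
    show "absval (A $ n) * r ^ n \<le> absval (U $ N) * r ^ N" for n
    proof -
      have "absval (U $ n) * r ^ n \<le> absval (U $ N) * r ^ N"
        using assms(1) unfolding dominant_def by blast
      thus ?thesis using le[of n] assms(3)[of n] by linarith
    qed
    show "absval (A $ n) * r ^ n < absval (U $ N) * r ^ N" if "n > N" for n
    proof -
      have "absval (U $ n) * r ^ n < absval (U $ N) * r ^ N"
        using assms(1) that unfolding dominant_def by blast
      thus ?thesis using le[of n] assms(3)[of n] by linarith
    qed
  qed
qed

section \<open>Linear factors and the dominant index\<close>

context dense_alg_closed
begin

text \<open>The Gauss norm is multiplicative and dominant indices add up. A factor
  \<open>X - w\<close> has index 1 if \<open>w\<close> lies in the disc and, in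
  \<open>dominant_linear_out\<close>, index 0 if it does not.\<close>

lemma dominant_linear_in:
  assumes Q: "dominant r N (Q::'a fps)" and w: "absval w \<le> r" and r: "0 < r"
  shows "dominant r (Suc N) ((fps_X - fps_const w) * Q)"
    and "absval (((fps_X - fps_const w) * Q) $ Suc N) = absval (Q $ N)"
proof -
  let ?U = "(fps_X - fps_const w) * Q"
  let ?q = "\<lambda>n. absval (Q $ n) * r ^ n"
  have U0: "?U $ 0 = - (w * Q $ 0)" and US: "?U $ Suc n = Q $ n - w * Q $ Suc n" for n
    by (simp_all add: fps_linear_nth)
  have le: "?q n \<le> ?q N" for n using Q by (auto simp: dominant_def)
  have less: "?q n < ?q N" if "n > N" for n using Q that by (auto simp: dominant_def)
  have wr: "absval (w * Q $ n) * r ^ n \<le> r * ?q n" for n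
    using mult_right_mono[OF w, of "?q n"] r by (simp add: absval_mult mult_ac)
  have "absval (w * Q $ Suc N) * r ^ Suc N < absval (Q $ N) * r ^ Suc N"
    using wr[of "Suc N"] mult_strict_left_mono[OF less[of "Suc N"] r] by (simp add: mult_ac)
  hence *: "absval (w * Q $ Suc N) < absval (Q $ N)" using r by simp
  show eq: "absval (?U $ Suc N) = absval (Q $ N)"
    unfolding US using absval_add_eq[of "- (w * Q $ Suc N)" "Q $ N"] * by simp
  \<comment> \<open>A coefficient of the product involves two neighbouring coefficients of
    \<open>Q\<close>; for \<open>n = 0\<close> one of them is absent, hence the guard
    \<open>n > 0\<close>.\<close>
  have bound: "absval (?U $ n) * r ^ n \<le> B"
    if "n > 0 \<Longrightarrow> r * ?q (n - 1) \<le> B" "r * ?q n \<le> B" for n B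
  proof (cases n)
    case 0
    thus ?thesis using that(2) wr[of 0] by (simp add: U0)
  next
    case (Suc m)
    have "absval (Q $ m) * r ^ n \<le> B" using that(1) Suc by (simp add: mult_ac)
    moreover have "absval (w * Q $ Suc m) * r ^ n \<le> B" using that(2) wr[of n] Suc by simp
    ultimately show ?thesis
      using absval_diff_le[of "Q $ m" "B / r ^ n" "w * Q $ Suc m"] r Suc
      unfolding US Suc by (simp add: pos_le_divide_eq)
  qed
  show "dominant r (Suc N) ?U"
    unfolding dominant_def eq
  proof (intro conjI allI impI)
    show "?U $ Suc N \<noteq> 0"
      using eq Q unfolding dominant_def by (metis absval_eq_0_iff)
    show "absval (?U $ n) * r ^ n \<le> absval (Q $ N) * r ^ Suc N" for n
      using mult_left_mono[OF le[of "n - 1"], of r] mult_left_mono[OF le[of n], of r] r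
      by (intro bound) (simp_all add: mult_ac)
    fix n assume n: "n > Suc N"
    have 1: "r * ?q (n - 1) < absval (Q $ N) * r ^ Suc N" "r * ?q n < absval (Q $ N) * r ^ Suc N"
      using mult_strict_left_mono[OF less[of "n - 1"], of r] mult_strict_left_mono[OF less[of n], of r] r n
      by (simp_all add: mult_ac)
    show "absval (?U $ n) * r ^ n < absval (Q $ N) * r ^ Suc N"
      by (rule le_less_trans[OF bound[of n "max (r * ?q (n - 1)) (r * ?q n)"]]) (use 1 in auto)
  qed
qed

lemma dominant_linear_out:
  assumes Q: "dominant r N (Q::'a fps)" and w: "absval w > r" and r: "0 < r"
  shows "dominant r N ((fps_X - fps_const w) * Q)"
proof -
  let ?U = "(fps_X - fps_const w) * Q"
  let ?q = "\<lambda>n. absval (Q $ n) * r ^ n"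
  have w0: "absval w > 0" using w r by linarith
  have U0: "?U $ 0 = - (w * Q $ 0)" and US: "?U $ Suc n = Q $ n - w * Q $ Suc n" for n
    by (simp_all add: fps_linear_nth)
  have le: "?q n \<le> ?q N" for n using Q by (auto simp: dominant_def)
  have less: "?q n < ?q N" if "n > N" for n using Q that by (auto simp: dominant_def)
  have qN: "?q N > 0" using Q r by (auto simp: dominant_def)
  \<comment> \<open>As \<open>r < absval w\<close>, the contribution of the factor \<open>X\<close>
    stays strictly below the maximum contributed by \<open>w\<close>.\<close>
  have shift: "absval (Q $ m) * r ^ Suc m < absval w * ?q N" for m
  proof -
    have "absval (Q $ m) * r ^ Suc m = r * ?q m" by simp
    also have "\<dots> \<le> r * ?q N" using le[of m] r by simp
    also have "\<dots> < absval w * ?q N" by (rule mult_strict_right_mono[OF w qN])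
    finally show ?thesis .
  qed
  have eq: "absval (?U $ N) = absval w * absval (Q $ N)"
  proof (cases N)
    case 0
    thus ?thesis by (simp add: U0 absval_mult)
  next
    case (Suc m)
    have "absval (Q $ m) * r ^ N < absval (w * Q $ N) * r ^ N"
      using shift[of m] Suc by (simp add: absval_mult mult_ac)
    hence "absval (Q $ m) < absval (w * Q $ N)" using r by simp
    hence "absval (Q $ m + - (w * Q $ N)) = absval (- (w * Q $ N))"
      by (intro absval_add_eq) simp
    thus ?thesis unfolding Suc US by (simp add: absval_mult)
  qed
  have bound: "absval (?U $ n) * r ^ n \<le> max (case n of 0 \<Rightarrow> 0 | Suc m \<Rightarrow> absval (Q $ m) * r ^ Suc m) (absval w * ?q n)" for n
  proof (cases n)
    case 0
    thus ?thesis by (simp add: U0 absval_mult)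
  next
    case (Suc m)
    have "absval (?U $ n) * r ^ n \<le> max (absval (Q $ m)) (absval (w * Q $ Suc m)) * r ^ n"
      unfolding Suc US using r by (intro mult_right_mono absval_diff) auto
    thus ?thesis unfolding Suc by (auto simp: max_def absval_mult mult_ac split: if_splits)
  qed
  show ?thesis
    unfolding dominant_def eq
  proof (intro conjI allI impI)
    show "?U $ N \<noteq> 0" using eq w0 Q unfolding dominant_def
      by (metis absval_eq_0_iff mult_eq_0_iff less_irrefl)
    fix n
    have 1: "(case n of 0 \<Rightarrow> 0 | Suc m \<Rightarrow> absval (Q $ m) * r ^ Suc m) < absval w * ?q N"
      using shift w0 qN by (cases n) auto
    have "absval w * ?q n \<le> absval w * ?q N" using le[of n] w0 by simp
    thus "absval (?U $ n) * r ^ n \<le> absval w * absval (Q $ N) * r ^ N"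
      using bound[of n] 1 by (simp add: mult_ac)
    assume "n > N"
    hence "absval w * ?q n < absval w * ?q N" using less[of n] w0 by simp
    thus "absval (?U $ n) * r ^ n < absval w * absval (Q $ N) * r ^ N"
      using bound[of n] 1 by (simp add: mult_ac)
  qed
qed

text \<open>On the disc the constant coefficient outweighs everything else. This is the base case of
  inductions that divide out zeros.\<close>

lemma absval_ev_dominant_0:
  assumes "entire_fps (U::'a fps)" "dominant r 0 U" "0 < r" "absval x \<le> r"
  shows "absval (ev U x) = absval (U $ 0)"
proof -
  define V where "V = U - fps_const (U $ 0)"
  have V: "entire_fps V" using assms(1) by (simp add: V_def)
  have U: "ev U x = ev V x + U $ 0" using assms(1) by (simp add: V_def)
  have "absval (ev V x) < absval (U $ 0)"
  proof (cases "V = 0")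
    case True
    thus ?thesis using assms(2) by (simp add: dominant_def)
  next
    case False
    \<comment> \<open>The maximum over the higher terms is attained, so the termwise strict
      inequalities become a uniform one.\<close>
    obtain M where M: "dominant r M V" using dominant_exists[OF V False assms(3)] .
    have "V $ M \<noteq> 0" using M by (simp add: dominant_def)
    hence "M > 0" by (intro gr0I) (auto simp: V_def)
    hence "absval (V $ M) * r ^ M < absval (U $ 0)"
      using assms(2) by (auto simp: V_def dominant_def)
    moreover have "absval (ev V x) \<le> absval (V $ M) * r ^ M"
      using M assms(4) by (intro ev_le[OF V]) (auto simp: dominant_def)
    ultimately show ?thesis by linarith
  qed
  thus ?thesis unfolding U by (rule absval_add_eq)
qed

text \<open>
  Stated for an arbitrary class of series because it is needed twice: for polynomials over \<open>L\<close>, where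
  roots come from algebraic closedness, in order to construct zeros of entire series; and then for
  all entire series.
\<close>

lemma near_root_class:
  assumes entire: "\<And>U::'a fps. C U \<Longrightarrow> entire_fps U"
    and split: "\<And>U N. C U \<Longrightarrow> dominant r (Suc N) U \<Longrightarrow>
      \<exists>w Q. absval w \<le> r \<and> C Q \<and> U = (fps_X - fps_const w) * Q"
    and r: "0 < r" and x: "absval x \<le> r"
    and U: "C U" "dominant r N U" and t: "0 \<le> t" "absval (ev U x) < absval (U $ N) * t ^ N"
  shows "\<exists>w. ev U w = 0 \<and> absval w \<le> r \<and> absval (x - w) < t"
proof (rule ccontr)
  \<comment> \<open>Divide out \<open>N\<close> zeros \<open>w\<close> in the disc: each factor
    \<open>x - w\<close> has absolute value at least \<open>t\<close>, and what remains has constant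
    absolute value \<open>absval (U $ N)\<close> on the disc.\<close>
  have "absval (U $ N) * t ^ N \<le> absval (ev U x)"
    if "\<And>w. ev U w = 0 \<Longrightarrow> absval w \<le> r \<Longrightarrow> t \<le> absval (x - w)"
    using U that
  proof (induction N arbitrary: U)
    case 0
    thus ?case using absval_ev_dominant_0[OF entire] r x by simp
  next
    case (Suc N)
    obtain w Q where w: "absval w \<le> r" and Q: "C Q" and UQ: "U = (fps_X - fps_const w) * Q"
      using split[OF Suc.prems(1,2)] by blast
    have evU: "ev U y = (y - w) * ev Q y" for y using entire[OF Q] by (simp add: UQ)
    have "Q \<noteq> 0" using Suc.prems(2) by (auto simp: UQ dominant_def)
    then obtain M where M: "dominant r M Q" using dominant_exists[OF entire[OF Q] _ r] by blast
    have "M = N"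
      using dominant_unique[OF Suc.prems(2)[unfolded UQ] dominant_linear_in(1)[OF M w r]] by simp
    with M have N: "dominant r N Q" by simp
    have "absval (Q $ N) * t ^ N \<le> absval (ev Q x)"
      by (rule Suc.IH[OF Q N]) (use Suc.prems(3) evU in auto)
    moreover have "t \<le> absval (x - w)" using Suc.prems(3)[of w] evU w by simp
    ultimately have "t * (absval (Q $ N) * t ^ N) \<le> absval (x - w) * absval (ev Q x)"
      using t(1) by (intro mult_mono) auto
    thus ?case using dominant_linear_in(2)[OF N w r]
      unfolding evU absval_mult[of "x - w"] by (simp add: UQ mult.left_commute)
  qed
  moreover assume "\<nexists>w. ev U w = 0 \<and> absval w \<le> r \<and> absval (x - w) < t"
  ultimately show False using t(2) by force
qed

section \<open>Roots of polynomials over L\<close>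

lemma poly_in_L: "(\<And>i. coeff P i \<in> L) \<Longrightarrow> x \<in> L \<Longrightarrow> poly P x \<in> L"
proof (induction P)
  case (pCons a P)
  have "coeff P i \<in> L" for i using pCons.prems(1)[of "Suc i"] by simp
  moreover have "a \<in> L" using pCons.prems(1)[of 0] by simp
  ultimately show ?case using pCons by (auto intro!: L_simps)
qed (auto simp: L_simps)

lemma synthetic_div_in_L: "(\<And>i. coeff P i \<in> L) \<Longrightarrow> x \<in> L \<Longrightarrow> coeff (synthetic_div P x) i \<in> L"
proof (induction P arbitrary: i)
  case (pCons a P)
  have P: "coeff P i \<in> L" for i using pCons.prems(1)[of "Suc i"] by simp
  hence "poly P x \<in> L" by (intro poly_in_L pCons.prems(2))
  thus ?case using pCons.IH[OF P pCons.prems(2)] by (simp add: coeff_pCons split: nat.split)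
qed (auto simp: L_simps)

lemma fps_of_poly_root:
  assumes "poly P (w::'a) = 0"
  shows "fps_of_poly P = (fps_X - fps_const w) * fps_of_poly (synthetic_div P w)"
proof -
  have "P = [:-w, 1:] * synthetic_div P w" using synthetic_div_correct'[of w P] assms by simp
  hence "fps_of_poly P = fps_of_poly [:-w, 1:] * fps_of_poly (synthetic_div P w)"
    by (metis fps_of_poly_mult)
  also have "fps_of_poly [:-w, 1:] = fps_X - fps_const w" by (simp add: fps_of_poly_pCons)
  finally show ?thesis .
qed

text \<open>A root in \<open>L\<close> that lies outside the disc is divided out. This lowers the
  degree but keeps the positive dominant index, so a root inside the disc has to turn up.\<close>

lemma poly_root_in_disc:
  assumes "\<And>i. coeff P i \<in> L" "dominant r (Suc N) (fps_of_poly P)" "0 < r"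
  shows "\<exists>w\<in>L. absval w \<le> r \<and> poly P w = 0"
  using assms(1,2)
proof (induction "degree P" arbitrary: P rule: less_induct)
  case less
  have "coeff P (Suc N) \<noteq> 0" using less.prems(2) by (auto simp: dominant_def)
  hence deg: "degree P > 0" using le_degree[of P "Suc N"] by simp
  obtain w where w: "w \<in> L" "poly P w = 0" using root_ex[OF deg less.prems(1)] by blast
  show ?case
  proof (cases "absval w \<le> r")
    case True
    thus ?thesis using w by blast
  next
    case False
    define Q where "Q = synthetic_div P w"
    have P: "fps_of_poly P = (fps_X - fps_const w) * fps_of_poly Q"
      using fps_of_poly_root[OF w(2)] by (simp add: Q_def)
    have "fps_of_poly Q \<noteq> 0" using less.prems(2) by (auto simp: P dominant_def)
    then obtain M where M: "dominant r M (fps_of_poly Q)"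
      using dominant_exists[OF entire_fps_of_poly _ assms(3)] by blast
    have "M = Suc N"
      using dominant_unique[OF less.prems(2)[unfolded P] dominant_linear_out[OF M _ assms(3)]] False
      by simp
    moreover have "degree Q < degree P" using deg by (simp add: Q_def degree_synthetic_div)
    moreover have "coeff Q i \<in> L" for i
      unfolding Q_def by (intro synthetic_div_in_L less.prems(1) w)
    ultimately obtain w' where w': "w' \<in> L" "absval w' \<le> r" "poly Q w' = 0"
      using less.hyps[of Q] M by blast
    have "poly P w' = 0" using arg_cong[OF P, of "\<lambda>U. ev U w'"] w' by simp
    thus ?thesis using w' by blast
  qed
qed

lemma near_root_poly:
  assumes "\<And>i. coeff P i \<in> L" "dominant r N (fps_of_poly P)" "0 < r" "absval x \<le> r"
    "0 \<le> t" "absval (poly P x) < absval (coeff P N) * t ^ N"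
  shows "\<exists>w. poly P w = 0 \<and> absval w \<le> r \<and> absval (x - w) < t"
proof -
  define C where "C U \<longleftrightarrow> (\<exists>P. U = fps_of_poly P \<and> (\<forall>i. coeff P i \<in> L))" for U
  have "\<exists>w. ev (fps_of_poly P) w = 0 \<and> absval w \<le> r \<and> absval (x - w) < t"
  proof (rule near_root_class[where C = C])
    show "entire_fps U" if "C U" for U using that by (auto simp: C_def)
    fix U N assume U: "C U" "dominant r (Suc N) U"
    then obtain P where P: "U = fps_of_poly P" "\<And>i. coeff P i \<in> L" by (auto simp: C_def)
    obtain w where w: "w \<in> L" "absval w \<le> r" "poly P w = 0"
      using poly_root_in_disc[OF P(2)] U(2) P(1) assms(3) by blast
    have "C (fps_of_poly (synthetic_div P w))"
      using synthetic_div_in_L[OF P(2) w(1)] by (auto simp: C_def)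
    thus "\<exists>w Q. absval w \<le> r \<and> C Q \<and> U = (fps_X - fps_const w) * Q"
      using fps_of_poly_root[OF w(3)] P(1) w(2) by blast
  qed (use assms in \<open>auto simp: C_def\<close>)
  thus ?thesis by simp
qed

text \<open>Early coefficients are approximated from \<open>A\<close>; the later ones are already
  small and are replaced by 0, which therefore must belong to \<open>A\<close>. Applied with
  \<open>A = L\<close> and with the rationals.\<close>

lemma approx_by_poly:
  assumes U: "entire_fps (U::'a fps)" and r: "0 < r" and e: "0 < e"
    and A: "0 \<in> A" "\<And>n. U $ n \<in> closure A"
  shows "\<exists>P. (\<forall>i. coeff P i \<in> A) \<and> (\<forall>n. absval (coeff P n - U $ n) * r ^ n < e)"
proof -
  have "eventually (\<lambda>n. absval (U $ n) * r ^ n < e) sequentially"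
    by (rule order_tendstoD(2)[OF entire_fps_coeff_tendsto[OF U r] e])
  then obtain K where K: "\<And>n. n \<ge> K \<Longrightarrow> absval (U $ n) * r ^ n < e"
    by (auto simp: eventually_sequentially)
  have "\<forall>n. \<exists>y\<in>A. absval (y - U $ n) < e / r ^ n"
    using A(2) e r by (simp add: closure_approachable dist_absval)
  then obtain y where y: "\<And>n. y n \<in> A" "\<And>n. absval (y n - U $ n) < e / r ^ n" by metis
  define P where "P = Poly (map y [0..<K])"
  have P: "coeff P n = (if n < K then y n else 0)" for n
    by (auto simp: P_def coeff_Poly_eq nth_default_def)
  show ?thesis
  proof (intro exI[of _ P] conjI allI)
    show "coeff P i \<in> A" for i using y A by (auto simp: P)
    show "absval (coeff P n - U $ n) * r ^ n < e" for n
      using y(2)[of n] K[of n] r by (auto simp: P pos_less_divide_eq)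
  qed
qed

text \<open>Polynomials \<open>P m\<close> over \<open>L\<close> approximate \<open>U\<close> in the
  Gauss norm. A root of \<open>P m\<close> is almost a root of \<open>P (Suc m)\<close>, and
  \<open>near_root_poly\<close> yields a genuine root of the latter nearby. The roots chosen in this
  way converge, by completeness, to a zero of \<open>U\<close>.\<close>

lemma root_in_disc:
  assumes U: "entire_fps (U::'a fps)" and dom: "dominant r (Suc N) U" and r: "0 < r"
  shows "\<exists>w. absval w \<le> r \<and> ev U w = 0"
proof -
  define c where "c = absval (U $ Suc N)"
  have c: "c > 0" using dom by (simp add: c_def dominant_def)
  \<comment> \<open>The first bound preserves the dominant index and the size of the leading
    coefficient. The second makes the next root lie within \<open>(1/2) ^ m\<close>;
    \<open>Suc m\<close> leaves room for the strict inequality.\<close>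
  define e where "e m = min (c * r ^ Suc N) (c * ((1/2) ^ Suc m) ^ Suc N)" for m
  have e: "e m > 0" for m unfolding e_def using c r by (simp del: power_Suc)
  have "\<forall>m. \<exists>P. (\<forall>i. coeff P i \<in> L) \<and> (\<forall>n. absval (coeff P n - U $ n) * r ^ n < e m)"
    using approx_by_poly[OF U r e, of L] dense L_simps(1) by blast
  then obtain P where PL: "\<And>m i. coeff (P m) i \<in> L"
    and Pe: "\<And>m n. absval (coeff (P m) n - U $ n) * r ^ n < e m" by metis
  have Pdom: "dominant r (Suc N) (fps_of_poly (P m))" "absval (coeff (P m) (Suc N)) = c" for m
  proof -
    have *: "absval (fps_of_poly (P m) $ n - U $ n) * r ^ n < absval (U $ Suc N) * r ^ Suc N" for n
      using Pe[of m n] by (simp add: e_def c_def)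
    show "dominant r (Suc N) (fps_of_poly (P m))" by (rule dominant_perturb(1)[OF dom r *])
    show "absval (coeff (P m) (Suc N)) = c" using dominant_perturb(2)[OF dom r *] by (simp add: c_def)
  qed
  have Pclose: "absval (poly (P m) x - ev U x) \<le> e m" if "absval x \<le> r" for m x
    using ev_le[of "fps_of_poly (P m) - U" x r "e m"] U that Pe[of m] by (simp add: less_imp_le)
  have "\<exists>z. \<forall>m. (absval (z m) \<le> r \<and> poly (P m) (z m) = 0) \<and> absval (z m - z (Suc m)) < (1/2) ^ m"
  proof (rule dependent_nat_choice)
    show "\<exists>x. absval x \<le> r \<and> poly (P 0) x = 0"
      using poly_root_in_disc[OF PL Pdom(1) r] by blast
    fix x m assume x: "absval x \<le> r \<and> poly (P m) x = 0"
    define m' where "m' = Suc m"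
    have "poly (P m') x = (poly (P m') x - ev U x) - (poly (P m) x - ev U x)" using x by simp
    also have "absval \<dots> \<le> e m"
    proof (rule absval_diff_le)
      have "((1/2::real) ^ Suc m') ^ Suc N \<le> ((1/2) ^ Suc m) ^ Suc N"
        by (intro power_mono power_decreasing) (auto simp: m'_def)
      hence "c * ((1/2) ^ Suc m') ^ Suc N \<le> c * ((1/2) ^ Suc m) ^ Suc N"
        using c by (intro mult_left_mono) auto
      hence "e m' \<le> e m" unfolding e_def by linarith
      thus "absval (poly (P m') x - ev U x) \<le> e m" using Pclose[of x m'] x by simp
      show "absval (poly (P m) x - ev U x) \<le> e m" using Pclose x by blast
    qed
    finally have le: "absval (poly (P m') x) \<le> e m" .
    show "\<exists>y. (absval y \<le> r \<and> poly (P (Suc m)) y = 0) \<and> absval (x - y) < (1/2) ^ m"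
    proof -
      have "e m \<le> c * ((1/2) ^ Suc m) ^ Suc N" by (simp only: e_def)
      also have "\<dots> < c * ((1/2) ^ m) ^ Suc N"
        using c by (intro mult_strict_left_mono power_strict_mono) auto
      finally have "absval (poly (P m') x) < absval (coeff (P m') (Suc N)) * ((1/2) ^ m) ^ Suc N"
        using le by (simp only: Pdom(2))
      from near_root_poly[OF PL Pdom(1) r _ _ this] show ?thesis
        using x by (auto simp: m'_def)
    qed
  qed
  then obtain z where z: "\<And>m. absval (z m) \<le> r" "\<And>m. poly (P m) (z m) = 0"
    "\<And>m. absval (z m - z (Suc m)) < (1/2) ^ m" by blast
  have half: "(\<lambda>m. (1/2::real) ^ m) \<longlonglongrightarrow> 0" by (rule LIMSEQ_realpow_zero) auto
  have "(\<lambda>m. absval (z m - z (Suc m))) \<longlonglongrightarrow> 0"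
    by (rule tendsto_sandwich[OF always_eventually always_eventually tendsto_const half])
      (use z(3) in \<open>auto intro: less_imp_le\<close>)
  \<comment> \<open>Consecutive differences tending to 0 suffice: the telescoping series converges
    by \<open>summable_nonarch\<close>.\<close>
  hence "(\<lambda>m. z (Suc m) - z m) \<longlonglongrightarrow> 0"
    by (intro tendsto_zero_absvalI) (simp add: absval_minus_commute)
  hence "summable (\<lambda>m. z (Suc m) - z m)" by (rule summable_nonarch)
  hence "(\<lambda>n. \<Sum>m<n. z (Suc m) - z m) \<longlonglongrightarrow> (\<Sum>m. z (Suc m) - z m)" by (rule summable_LIMSEQ)
  hence "(\<lambda>n. z n - z 0) \<longlonglongrightarrow> (\<Sum>m. z (Suc m) - z m)" by (simp add: sum_lessThan_telescope)
  from tendsto_add[OF this tendsto_const[of "z 0"]] obtain l where l: "z \<longlonglongrightarrow> l" by auto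
  have "(\<lambda>m. ev U (z m)) \<longlonglongrightarrow> ev U l"
    using isCont_ev[OF U, of l] l by (intro isCont_tendsto_compose[of l "ev U"]) (auto simp: isCont_def)
  moreover have "(\<lambda>m. ev U (z m)) \<longlonglongrightarrow> 0"
  proof (rule tendsto_zero_absvalI)
    have le: "absval (ev U (z m)) \<le> c * ((1/2) ^ Suc m) ^ Suc N" for m
      using Pclose[OF z(1), of m m] unfolding z(2) e_def by simp
    have "(\<lambda>m. c * ((1/2) ^ Suc m) ^ Suc N) \<longlonglongrightarrow> c * 0 ^ Suc N"
      by (intro tendsto_mult tendsto_const tendsto_power LIMSEQ_Suc half)
    hence lim: "(\<lambda>m. c * ((1/2) ^ Suc m) ^ Suc N) \<longlonglongrightarrow> 0" by simp
    show "(\<lambda>m. absval (ev U (z m))) \<longlonglongrightarrow> 0"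
      by (rule tendsto_sandwich[OF always_eventually always_eventually tendsto_const lim])
        (use le in auto)
  qed
  ultimately have "ev U l = 0" using LIMSEQ_unique by blast
  moreover have "absval l \<le> r" using l z(1) by (rule absval_lim_le)
  ultimately show ?thesis by blast
qed

lemma near_root:
  assumes "entire_fps (U::'a fps)" "dominant r N U" "0 < r" "absval x \<le> r"
    "0 \<le> t" "absval (ev U x) < absval (U $ N) * t ^ N"
  shows "\<exists>w. ev U w = 0 \<and> absval w \<le> r \<and> absval (x - w) < t"
proof (rule near_root_class[where C = entire_fps])
  fix U :: "'a fps" and N assume U: "entire_fps U" "dominant r (Suc N) U"
  obtain w where "absval w \<le> r" "ev U w = 0" using root_in_disc[OF U assms(3)] by blast
  thus "\<exists>w Q. absval w \<le> r \<and> entire_fps Q \<and> U = (fps_X - fps_const w) * Q"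
    using root_factor[OF U(1)] by metis
qed (use assms in auto)

end

section \<open>Meromorphic functions as quotients of entire series\<close>

lemma fraction_value_cong:
  assumes "eventually (\<lambda>z. u z / v z = u' z / v' z) (at x)"
  shows "fraction_value u v x = fraction_value u' v' x"
proof -
  have "((\<lambda>z. u z / v z) \<longlongrightarrow> y) (at x) \<longleftrightarrow> ((\<lambda>z. u' z / v' z) \<longlongrightarrow> y) (at x)" for y
    by (rule tendsto_cong[OF assms])
  thus ?thesis by (simp add: fraction_value_def Topological_Spaces.Lim_def)
qed

section \<open>Surjectivity, orders of zeros and cancellation\<close>

context dense_alg_closed
begin

text \<open>At a large radius the term of index \<open>n\<close> beats the constant term of
  \<open>U - y\<close>. The dominant index is then positive, and \<open>root_in_disc\<close>
  applies.\<close>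

lemma ev_surj:
  assumes U: "entire_fps (U::'a fps)" and n: "n > 0" "U $ n \<noteq> 0"
  shows "\<exists>x. ev U x = y"
proof -
  define V where "V = U - fps_const y"
  have V: "entire_fps V" "V $ n = U $ n" using U n by (auto simp: V_def)
  \<comment> \<open>The quotient makes \<open>absval (U $ n) * r\<close> exceed
    \<open>absval (V $ 0)\<close>, and \<open>r \<ge> 1\<close> passes this on to
    \<open>r ^ n\<close>.\<close>
  define r where "r = max 1 ((absval (V $ 0) + 1) / absval (U $ n))"
  have r: "r \<ge> 1" by (simp add: r_def)
  have "absval (V $ 0) < absval (U $ n) * ((absval (V $ 0) + 1) / absval (U $ n))"
    using n by simp
  also have "\<dots> \<le> absval (U $ n) * r" by (intro mult_left_mono) (auto simp: r_def)
  also have "\<dots> \<le> absval (U $ n) * r ^ n"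
    using r n by (intro mult_left_mono self_le_power) auto
  finally have less: "absval (V $ 0) < absval (V $ n) * r ^ n" using V by simp
  have "V \<noteq> 0" using V(2) n(2) by auto
  then obtain N where N: "dominant r N V" using dominant_exists[OF V(1)] r by (metis zero_less_one less_le_trans)
  have "N \<noteq> 0"
  proof
    assume "N = 0"
    hence "absval (V $ n) * r ^ n \<le> absval (V $ 0)" using N by (auto simp: dominant_def)
    thus False using less by simp
  qed
  then obtain M where "N = Suc M" by (cases N) auto
  then obtain x where "ev V x = 0" using root_in_disc[OF V(1), of r M] N r by auto
  thus ?thesis using U by (auto simp: V_def)
qed

lemma dominant_quotient:
  assumes "entire_fps (Q::'a fps)" "dominant r N ((fps_X - fps_const w) * Q)" "absval w \<le> r" "0 < r"
  obtains M where "N = Suc M" "dominant r M Q"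
proof -
  have "Q \<noteq> 0" using assms(2) by (auto simp: dominant_def)
  then obtain M where M: "dominant r M Q" using dominant_exists assms(1,4) by blast
  have "N = Suc M" using dominant_unique[OF assms(2) dominant_linear_in(1)[OF M assms(3,4)]] .
  thus thesis using that M by blast
qed

text \<open>On a disc containing \<open>w\<close> the dominant index drops by one with each factor
  \<open>X - w\<close>, so the order of a zero is finite.\<close>

lemma order_at:
  assumes U: "entire_fps (U::'a fps)" "U \<noteq> 0"
  obtains k V where "entire_fps V" "U = (fps_X - fps_const w) ^ k * V" "ev V w \<noteq> 0"
proof -
  define r where "r = absval w + 1"
  have r: "r > 0" "absval w \<le> r" by (simp_all add: r_def add_nonneg_pos)
  obtain N where N: "dominant r N U" using dominant_exists[OF U r(1)] .
  have "\<exists>k V. entire_fps V \<and> U = (fps_X - fps_const w) ^ k * V \<and> ev V w \<noteq> 0"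
    using U(1) N
  proof (induction N arbitrary: U rule: less_induct)
    case (less N U)
    show ?case
    proof (cases "ev U w = 0")
      case False
      thus ?thesis using less.prems by (intro exI[of _ 0] exI[of _ U]) simp
    next
      case True
      obtain Q where Q: "entire_fps Q" "U = (fps_X - fps_const w) * Q"
        using root_factor[OF less.prems(1) True] .
      obtain M where M: "N = Suc M" "dominant r M Q"
        using dominant_quotient[OF Q(1) less.prems(2)[unfolded Q(2)] r(2,1)] .
      obtain k V where "entire_fps V" "Q = (fps_X - fps_const w) ^ k * V" "ev V w \<noteq> 0"
        using less.IH[OF _ Q(1) M(2)] M(1) by auto
      thus ?thesis using Q(2) by (intro exI[of _ "Suc k"] exI[of _ V]) (simp add: mult_ac)
    qed
  qed
  thus thesis using that by blast
qed

lemma eventually_neq_at: "eventually (\<lambda>x. x \<noteq> (w::'a)) (at w)"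
  by (auto simp: eventually_at_filter)

lemma eventually_ev_neq_0:
  assumes "entire_fps (U::'a fps)" "U \<noteq> 0"
  shows "eventually (\<lambda>x. ev U x \<noteq> 0) (at w)"
proof -
  obtain k V where V: "entire_fps V" "U = (fps_X - fps_const w) ^ k * V" "ev V w \<noteq> 0"
    using order_at[OF assms] .
  have "eventually (\<lambda>x. ev V x \<noteq> 0) (at w)"
    using isCont_ev[OF V(1)] V(3) by (rule tendsto_imp_eventually_nz)
  thus ?thesis using eventually_neq_at[of w]
    by eventually_elim (simp add: V(1,2))
qed

lemma ev_eq_0_imp:
  assumes "entire_fps (U::'a fps)" "\<And>x. ev U x = 0"
  shows "U = 0"
proof (rule ccontr)
  assume "U \<noteq> 0"
  from eventually_ev_neq_0[OF assms(1) this, of 0] have "eventually (\<lambda>x::'a. False) (at 0)"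
    by eventually_elim (simp add: assms(2))
  thus False using at_neq_bot by (simp add: eventually_False)
qed

lemma ev_eq_imp:
  assumes "entire_fps (U::'a fps)" "entire_fps V" "\<And>x. ev U x = ev V x"
  shows "U = V"
  using ev_eq_0_imp[of "U - V"] assms by simp

text \<open>By \<open>ev_surj\<close>, nothing plays the role of the complex exponential.\<close>

lemma zero_free_const:
  assumes "entire_fps (U::'a fps)" "\<And>x. ev U x \<noteq> 0"
  shows "U = fps_const (U $ 0)"
proof (rule fps_ext)
  fix n
  show "U $ n = fps_const (U $ 0) $ n"
    using ev_surj[OF assms(1), of n 0] assms(2) by (cases "n = 0") auto
qed

lemma X_minus_neq_0: "fps_X - fps_const (w::'a) \<noteq> 0"
proof
  assume "fps_X - fps_const w = 0"
  hence "(fps_X - fps_const w) $ 1 = 0" by simp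
  thus False by simp
qed

text \<open>Coprimality is used at one point at a time, so it suffices to cancel a power of
  \<open>X - w\<close>; a globally reduced fraction is never constructed.\<close>

lemma cancel_at:
  assumes "entire_fps (U::'a fps)" "entire_fps V" "V \<noteq> 0"
  obtains W U1 V1 where "entire_fps W" "W \<noteq> 0" "entire_fps U1" "entire_fps V1" "V1 \<noteq> 0" "U = W * U1" "V = W * V1"
    "ev U1 w \<noteq> 0 \<or> ev V1 w \<noteq> 0"
proof -
  obtain m V' where V': "entire_fps V'" "V = (fps_X - fps_const w) ^ m * V'" "ev V' w \<noteq> 0"
    using order_at[OF assms(2,3)] .
  have "\<exists>k U1 V1. entire_fps U1 \<and> entire_fps V1 \<and> U = (fps_X - fps_const w) ^ k * U1 \<and>
      (fps_X - fps_const w) ^ m * V' = (fps_X - fps_const w) ^ k * V1 \<and> (ev U1 w \<noteq> 0 \<or> ev V1 w \<noteq> 0)"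
    using assms(1)
  proof (induction m arbitrary: U)
    case 0
    thus ?case using V' by (intro exI[of _ 0] exI[of _ U] exI[of _ V']) simp
  next
    case (Suc m)
    show ?case
    proof (cases "ev U w = 0")
      case False
      thus ?thesis using Suc.prems V'(1)
        by (intro exI[of _ 0] exI[of _ U] exI[of _ "(fps_X - fps_const w) ^ Suc m * V'"]) simp
    next
      case True
      obtain Q where Q: "entire_fps Q" "U = (fps_X - fps_const w) * Q"
        using root_factor[OF Suc.prems True] .
      from Suc.IH[OF Q(1)] obtain k U1 V1 where *: "entire_fps U1" "entire_fps V1"
        "Q = (fps_X - fps_const w) ^ k * U1"
        "(fps_X - fps_const w) ^ m * V' = (fps_X - fps_const w) ^ k * V1" "ev U1 w \<noteq> 0 \<or> ev V1 w \<noteq> 0"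
        by blast
      have "U = (fps_X - fps_const w) ^ Suc k * U1" unfolding Q(2) *(3) by (simp add: mult_ac)
      moreover have "(fps_X - fps_const w) ^ Suc m * V' = (fps_X - fps_const w) ^ Suc k * V1"
        using *(4) by (simp add: mult.assoc)
      ultimately show ?thesis using * by blast
    qed
  qed
  then obtain k U1 V1 where *: "entire_fps U1" "entire_fps V1" "U = (fps_X - fps_const w) ^ k * U1"
      "V = (fps_X - fps_const w) ^ k * V1" "ev U1 w \<noteq> 0 \<or> ev V1 w \<noteq> 0"
    unfolding V'(2)[symmetric] by blast
  show thesis
  proof (rule that[of "(fps_X - fps_const w) ^ k" U1 V1])
    show "V1 \<noteq> 0" using *(4) assms(3) by auto
  qed (use * X_minus_neq_0 in auto)
qed

lemma fraction_value_mult: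
  assumes "entire_fps (U::'a fps)" "entire_fps V" "entire_fps W" "W \<noteq> 0"
  shows "fraction_value (ev (W * U)) (ev (W * V)) x = fraction_value (ev U) (ev V) x"
proof (rule fraction_value_cong)
  show "eventually (\<lambda>z. ev (W * U) z / ev (W * V) z = ev U z / ev V z) (at x)"
    using eventually_ev_neq_0[OF assms(3,4)] by eventually_elim (simp add: assms)
qed

lemma fraction_value_Some:
  assumes "entire_fps (U::'a fps)" "entire_fps V" "ev V x \<noteq> 0"
  shows "fraction_value (ev U) (ev V) x = Some (ev U x / ev V x)"
proof -
  have lim: "((\<lambda>z. ev U z / ev V z) \<longlongrightarrow> ev U x / ev V x) (at x)"
    by (rule tendsto_divide_nonarch[OF isCont_ev isCont_ev]) (use assms in auto)
  thus ?thesis using tendsto_Lim[OF at_neq_bot lim] by (auto simp: fraction_value_def)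
qed

lemma fraction_value_None:
  assumes "entire_fps (U::'a fps)" "entire_fps V" "V \<noteq> 0" "ev V x = 0" "ev U x \<noteq> 0"
  shows "fraction_value (ev U) (ev V) x = None"
proof -
  have False if lim: "((\<lambda>z. ev U z / ev V z) \<longlongrightarrow> y) (at x)" for y
  proof -
    have "((\<lambda>z. ev U z / ev V z * ev V z) \<longlongrightarrow> y * ev V x) (at x)"
      by (intro tendsto_mult lim isCont_ev assms)
    moreover have "eventually (\<lambda>z. ev U z / ev V z * ev V z = ev U z) (at x)"
      using eventually_ev_neq_0[OF assms(2,3)] by eventually_elim simp
    ultimately have "(ev U \<longlongrightarrow> y * ev V x) (at x)" using tendsto_cong by force
    hence "ev U x = y * ev V x"
      using tendsto_unique[OF at_neq_bot isCont_ev[OF assms(1)]] by blast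
    thus False using assms by simp
  qed
  thus ?thesis by (auto simp: fraction_value_def)
qed

text \<open>In the absence of poles each zero of \<open>V\<close> in the disc is a zero of
  \<open>U\<close>. Cancelling these finitely many common zeros leaves a denominator without zeros
  in the disc. The factor \<open>W\<close> depends on \<open>r\<close>.\<close>

lemma no_pole_split:
  assumes r: "r > 0" and U: "entire_fps (U::'a fps)" "entire_fps V" "V \<noteq> 0"
    and np: "\<And>x. fraction_value (ev U) (ev V) x \<noteq> None"
  obtains W U1 V1 where "entire_fps W" "W \<noteq> 0" "entire_fps U1" "entire_fps V1" "U = W * U1" "V = W * V1"
    "dominant r 0 V1"
proof -
  obtain N where N: "dominant r N V" using dominant_exists[OF U(2,3) r] .
  have "\<exists>W U1 V1. entire_fps W \<and> W \<noteq> 0 \<and> entire_fps U1 \<and> entire_fps V1 \<and> U = W * U1 \<and> V = W * V1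
    \<and> dominant r 0 V1"
    using U np N
  proof (induction N arbitrary: U V)
    case 0
    thus ?case by (intro exI[of _ 1] exI[of _ U] exI[of _ V]) simp
  next
    case (Suc N U V)
    obtain w where w: "absval w \<le> r" "ev V w = 0" using root_in_disc[OF Suc.prems(2,5) r] by blast
    have "ev U w = 0" using fraction_value_None[OF Suc.prems(1-3) w(2)] Suc.prems(4) by blast
    obtain P where P: "entire_fps P" "U = (fps_X - fps_const w) * P"
      using root_factor[OF Suc.prems(1) \<open>ev U w = 0\<close>] .
    obtain Q where Q: "entire_fps Q" "V = (fps_X - fps_const w) * Q"
      using root_factor[OF Suc.prems(2) w(2)] .
    have "dominant r N Q"
      using dominant_quotient[OF Q(1) Suc.prems(5)[unfolded Q(2)] w(1) r] by (metis nat.inject)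
    moreover have "Q \<noteq> 0" using Suc.prems(3) Q(2) by auto
    moreover have "fraction_value (ev P) (ev Q) x \<noteq> None" for x
      using Suc.prems(4)[of x] fraction_value_mult[OF P(1) Q(1) _ X_minus_neq_0[of w], of x]
      by (simp add: P(2) Q(2))
    ultimately obtain W U1 V1 where *: "entire_fps W" "W \<noteq> 0" "entire_fps U1" "entire_fps V1"
      "P = W * U1" "Q = W * V1" "dominant r 0 V1"
      using Suc.IH[OF P(1) Q(1)] by blast
    show ?case
      by (intro exI[of _ "(fps_X - fps_const w) * W"] exI[of _ U1] exI[of _ V1])
        (use * X_minus_neq_0 P Q in \<open>auto simp: mult.assoc\<close>)
  qed
  thus thesis using that by blast
qed

text \<open>Solve \<open>U = V * Q\<close> recursively for \<open>Q $ n\<close>: by induction every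
  product \<open>V $ i * Q $ (n - i)\<close> satisfies the bound of \<open>U $ n\<close>, and the
  ultrametric inequality keeps it for their sum.\<close>

lemma dominant_0_quotient_bound:
  assumes r: "r > 0" and V: "dominant r 0 (V::'a fps)" and UVQ: "U = V * Q"
    and B: "\<And>n. absval (U $ n) * r ^ n \<le> B"
  shows "absval (Q $ n) * r ^ n \<le> B / absval (V $ 0)"
proof (induction n rule: less_induct)
  case (less n)
  define C where "C = B / absval (V $ 0)"
  have v: "absval (V $ 0) > 0" using V by (simp add: dominant_def)
  have "0 \<le> absval (U $ 0) * r ^ 0" by simp
  hence B0: "B \<ge> 0" using B[of 0] by linarith
  have "{0..n} = insert 0 {1..n}" by auto
  hence "U $ n = V $ 0 * Q $ n + (\<Sum>i=1..n. V $ i * Q $ (n - i))"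
    by (simp add: UVQ fps_mult_nth)
  hence "V $ 0 * Q $ n = U $ n - (\<Sum>i=1..n. V $ i * Q $ (n - i))" by simp
  moreover have "absval \<dots> \<le> B / r ^ n"
  proof (rule absval_diff_le)
    show "absval (U $ n) \<le> B / r ^ n" using B[of n] r by (simp add: pos_le_divide_eq)
    show "absval (\<Sum>i=1..n. V $ i * Q $ (n - i)) \<le> B / r ^ n"
    proof (rule absval_sum_le)
      fix i assume i: "i \<in> {1..n}"
      have "absval (V $ i) * r ^ i \<le> absval (V $ 0)" using V by (auto simp: dominant_def)
      moreover have "absval (Q $ (n - i)) * r ^ (n - i) \<le> B / absval (V $ 0)"
        using i by (intro less.IH) auto
      ultimately have "(absval (V $ i) * r ^ i) * (absval (Q $ (n - i)) * r ^ (n - i))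
          \<le> absval (V $ 0) * (B / absval (V $ 0))"
        using r by (intro mult_mono) auto
      also have "\<dots> = B" using v by simp
      also have "(absval (V $ i) * r ^ i) * (absval (Q $ (n - i)) * r ^ (n - i))
          = absval (V $ i * Q $ (n - i)) * r ^ n"
        using i by (simp add: absval_mult flip: power_add)
      finally show "absval (V $ i * Q $ (n - i)) \<le> B / r ^ n" using r by (simp add: pos_le_divide_eq)
    qed (use B0 r in simp)
  qed
  ultimately have "absval (V $ 0 * Q $ n) \<le> B / r ^ n" by simp
  thus ?case using v r by (simp add: absval_mult pos_le_divide_eq mult_ac)
qed

text \<open>The cancellation on the unit disc defines \<open>Q\<close> as a formal series. For any
  other radius a different cancellation represents the same \<open>Q\<close>, because series have no
  zero divisors, and bounds it there.\<close>

lemma entire_quotient: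
  assumes U: "entire_fps (U::'a fps)" "entire_fps V" "V \<noteq> 0"
    and np: "\<And>x. fraction_value (ev U) (ev V) x \<noteq> None"
  obtains Q where "entire_fps Q" "U = V * Q"
proof -
  obtain W U1 V1 where *: "U = W * U1" "V = W * V1" "dominant 1 0 V1"
    using no_pole_split[OF zero_less_one U np] by metis
  define Q where "Q = U1 * inverse V1"
  have "V1 * inverse V1 = 1"
    using *(3) by (intro inverse_mult_eq_1') (simp add: dominant_def)
  hence eq: "U = V * Q" by (simp add: Q_def * mult_ac)
  have "entire_fps Q"
    unfolding entire_fps_def
  proof (intro allI impI)
    fix r :: real assume r: "r > 0"
    obtain W U1 V1 where *: "W \<noteq> 0" "entire_fps U1" "U = W * U1" "V = W * V1" "dominant r 0 V1"
      using no_pole_split[OF r U np] by metis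
    have "W * U1 = W * (V1 * Q)" using eq *(3,4) by (simp add: mult.assoc)
    hence "U1 = V1 * Q" using *(1) by simp
    moreover obtain B where "\<And>n. absval (U1 $ n) * r ^ n \<le> B"
      using entire_fpsD[OF *(2) r] by blast
    ultimately show "\<exists>B. \<forall>n. absval (Q $ n) * r ^ n \<le> B"
      using dominant_0_quotient_bound[OF r *(5)] by blast
  qed
  thus thesis using that eq by blast
qed

lemma fraction_value_mult_left:
  assumes "entire_fps (V::'a fps)" "V \<noteq> 0" "entire_fps Q"
  shows "fraction_value (ev (V * Q)) (ev V) x = Some (ev Q x)"
  using fraction_value_mult[of Q 1 V x] fraction_value_Some[of Q 1 x] assms by simp

end

section \<open>Tangents and compositions of entire functions\<close>

text \<open>A point of \<open>E\<close> is determined by a nearby point of \<open>D\<close> together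
  with a radius of isolation \<open>1 / Suc n\<close>. Proximity within half that radius ensures
  that two points with the same label isolate each other.\<close>

lemma countable_isolated:
  fixes E :: "'b::metric_space set"
  assumes D: "countable D" "closure D = (UNIV :: 'b set)"
    and iso: "\<And>x. x \<in> E \<Longrightarrow> \<exists>d>0. \<forall>y\<in>E. dist x y < d \<longrightarrow> y = x"
  shows "countable E"
proof -
  have "\<exists>q n. q \<in> D \<and> dist q x < 1 / (2 * real (Suc n)) \<and>
      (\<forall>y\<in>E. dist x y < 1 / real (Suc n) \<longrightarrow> y = x)" if x: "x \<in> E" for x
  proof -
    obtain d where d: "d > 0" "\<And>y. y \<in> E \<Longrightarrow> dist x y < d \<Longrightarrow> y = x" using iso[OF x] by blast
    obtain n where n: "1 / real (Suc n) < d" using nat_approx_posE[OF d(1)] by blast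
    have "x \<in> closure D" using D(2) by simp
    then obtain q where "q \<in> D" "dist q x < 1 / (2 * real (Suc n))"
      unfolding closure_approachable by (metis zero_less_divide_1_iff of_nat_0_less_iff zero_less_Suc zero_less_mult_iff zero_less_numeral)
    thus ?thesis using d(2) n by (metis order.strict_trans)
  qed
  then obtain q n where q: "\<And>x. x \<in> E \<Longrightarrow> q x \<in> D" "\<And>x. x \<in> E \<Longrightarrow> dist (q x) x < 1 / (2 * real (Suc (n x)))"
    "\<And>x y. x \<in> E \<Longrightarrow> y \<in> E \<Longrightarrow> dist x y < 1 / real (Suc (n x)) \<Longrightarrow> y = x"
    by metis
  have "inj_on (\<lambda>x. (q x, n x)) E"
  proof (rule inj_onI)
    fix x y assume xy: "x \<in> E" "y \<in> E" "(q x, n x) = (q y, n y)"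
    have "dist x y \<le> dist (q x) x + dist (q x) y" by (metis dist_commute dist_triangle)
    also have "\<dots> < 1 / (2 * real (Suc (n x))) + 1 / (2 * real (Suc (n x)))"
      using q(2)[OF xy(1)] q(2)[OF xy(2)] xy(3) by (intro add_strict_mono) auto
    also have "\<dots> = 1 / real (Suc (n x))" by (simp add: field_simps)
    finally show "x = y" using q(3)[OF xy(1,2)] by simp
  qed
  moreover have "(\<lambda>x. (q x, n x)) ` E \<subseteq> D \<times> UNIV" using q(1) by auto
  hence "countable ((\<lambda>x. (q x, n x)) ` E)" by (rule countable_subset) (use D(1) in auto)
  ultimately show ?thesis by (metis countable_image_inj_on)
qed

text \<open>
  The slopes of the tangents to the graph of \<open>U\<close> that touch it in an inflection point or in two
  different points.
\<close>

definition special_slopes :: "'a::nonarch_field fps \<Rightarrow> 'a set" where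
  "special_slopes U =
     {ev (fps_deriv U) x | x. ev (fps_deriv (fps_deriv U)) x = 0} \<union>
     {ev (fps_deriv U) x | x y. x \<noteq> y \<and> ev (fps_deriv U) x = ev (fps_deriv U) y \<and>
        ev U x - x * ev (fps_deriv U) x = ev U y - y * ev (fps_deriv U) y \<and>
        ev (fps_deriv (fps_deriv U)) x \<noteq> 0 \<and> ev (fps_deriv (fps_deriv U)) y \<noteq> 0}"

context dense_alg_closed
begin

text \<open>The division identity is differentiated as an identity of formal series, so derivatives
  at \<open>w\<close> are read off without difference quotients.\<close>

lemma ev_remainder_deriv:
  assumes U: "entire_fps (U::'a fps)"
  obtains Q where "entire_fps Q" "U = fps_const (ev U w) + (fps_X - fps_const w) * Q"
    "\<And>x. ev U x = ev U w + (x - w) * ev Q x" "ev Q w = ev (fps_deriv U) w"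
    "ev (fps_deriv (fps_deriv U)) w = 2 * ev (fps_deriv Q) w"
proof -
  obtain Q where Q: "entire_fps Q" "U = fps_const (ev U w) + (fps_X - fps_const w) * Q"
    using ev_remainder[OF U] .
  have d1: "fps_deriv U = Q + (fps_X - fps_const w) * fps_deriv Q"
    by (subst Q(2)) (simp add: algebra_simps)
  have d2: "fps_deriv (fps_deriv U) = fps_deriv Q + fps_deriv Q + (fps_X - fps_const w) * fps_deriv (fps_deriv Q)"
    by (subst d1) (simp add: algebra_simps)
  show thesis
  proof (rule that[OF Q])
    show "ev U x = ev U w + (x - w) * ev Q x" for x
      using arg_cong[OF Q(2), of "\<lambda>V. ev V x"] Q(1) by simp
    show "ev Q w = ev (fps_deriv U) w" using Q(1) by (simp add: d1)
    show "ev (fps_deriv (fps_deriv U)) w = 2 * ev (fps_deriv Q) w"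
      using Q(1) entire_fps_of_poly[of "[:2::'a:]"] ev_of_poly[of "[:2:]" w] by (simp add: d2)
  qed
qed

lemma taylor2:
  assumes U: "entire_fps (U::'a fps)"
  obtains Q where "entire_fps Q"
    "\<And>x. ev U x = ev U w + (x - w) * ev (fps_deriv U) w + (x - w)\<^sup>2 * ev Q x"
    "ev (fps_deriv (fps_deriv U)) w = 2 * ev Q w"
proof -
  obtain P where P: "entire_fps P" "\<And>x. ev U x = ev U w + (x - w) * ev P x"
    "ev P w = ev (fps_deriv U) w" "ev (fps_deriv (fps_deriv U)) w = 2 * ev (fps_deriv P) w"
    using ev_remainder_deriv[OF U] by metis
  obtain Q where Q: "entire_fps Q" "\<And>x. ev P x = ev P w + (x - w) * ev Q x"
    "ev Q w = ev (fps_deriv P) w"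
    using ev_remainder_deriv[OF P(1)] by metis
  show thesis
  proof (rule that[OF Q(1)])
    show "ev U x = ev U w + (x - w) * ev (fps_deriv U) w + (x - w)\<^sup>2 * ev Q x" for x
      using P(2)[of x] Q(2)[of x] P(3) by (simp add: algebra_simps power2_eq_square)
    show "ev (fps_deriv (fps_deriv U)) w = 2 * ev Q w" using P(4) Q(3) by simp
  qed
qed

lemma ev_tendsto_at: "entire_fps (U::'a fps) \<Longrightarrow> ev U w = l \<Longrightarrow> (ev U \<longlongrightarrow> l) (at w)"
  using isCont_ev by blast

text \<open>
  Infinitesimally, the intercept \<open>c = U(x) - x U'(x)\<close> of the tangent at \<open>x\<close> satisfies
  \<open>dc = - x dU'\<close>. Hence tangents at \<open>x \<noteq> y\<close> cannot stay equal when \<open>x\<close> and \<open>y\<close> move.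
\<close>

lemma intercept_near:
  assumes U: "entire_fps (U::'a fps)" and nz: "ev (fps_deriv (fps_deriv U)) w \<noteq> 0" and e: "e > 0"
  shows "eventually (\<lambda>x. ev (fps_deriv U) x \<noteq> ev (fps_deriv U) w \<and>
    absval ((ev U x - x * ev (fps_deriv U) x) - (ev U w - w * ev (fps_deriv U) w)
      + w * (ev (fps_deriv U) x - ev (fps_deriv U) w))
    < e * absval (ev (fps_deriv U) x - ev (fps_deriv U) w)) (at w)"
proof -
  let ?D = "fps_deriv U"
  obtain P where P: "entire_fps P" "\<And>x. ev U x = ev U w + (x - w) * ev P x" "ev P w = ev ?D w"
    using ev_remainder_deriv[OF U] by metis
  obtain R where R: "entire_fps R" "\<And>x. ev ?D x = ev ?D w + (x - w) * ev R x"
    "ev R w = ev (fps_deriv ?D) w"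
    using ev_remainder_deriv[OF entire_fps_deriv[OF U]] by metis
  have Rlim: "(ev R \<longlongrightarrow> ev (fps_deriv ?D) w) (at w)" using R by (intro ev_tendsto_at)
  \<comment> \<open>Up to the common factor \<open>x - w\<close>, this is the error in the intercept
    divided by the change of slope. The nonzero second derivative is the limit of the
    denominator.\<close>
  have "((\<lambda>x. (ev P x - ev ?D x) / ev R x) \<longlongrightarrow> (ev ?D w - ev ?D w) / ev (fps_deriv ?D) w) (at w)"
    by (intro tendsto_divide_nonarch tendsto_diff ev_tendsto_at Rlim nz P R entire_fps_deriv U refl)
  hence "((\<lambda>x. absval ((ev P x - ev ?D x) / ev R x)) \<longlongrightarrow> 0) (at w)"
    by (simp add: tendsto_absval_iff)
  hence "eventually (\<lambda>x. absval ((ev P x - ev ?D x) / ev R x) < e) (at w)"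
    using e by (rule order_tendstoD(2))
  moreover have "eventually (\<lambda>x. ev R x \<noteq> 0) (at w)"
    using Rlim nz by (rule tendsto_imp_eventually_nz)
  ultimately show ?thesis
    using eventually_neq_at[of w]
  proof eventually_elim
    case (elim x)
    have d: "ev ?D x - ev ?D w = (x - w) * ev R x" using R(2)[of x] by simp
    have "(ev U x - x * ev ?D x) - (ev U w - w * ev ?D w) + w * (ev ?D x - ev ?D w)
        = (x - w) * (ev P x - ev ?D x)"
      using P(2)[of x] by (simp add: algebra_simps)
    moreover have "absval (ev P x - ev ?D x) < e * absval (ev R x)"
      using elim by (simp add: absval_divide pos_divide_less_eq)
    hence "absval (x - w) * absval (ev P x - ev ?D x) < absval (x - w) * (e * absval (ev R x))"
      using elim by (intro mult_strict_left_mono) auto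
    moreover have "ev ?D x \<noteq> ev ?D w" using d elim by auto
    ultimately show ?case unfolding d by (simp add: absval_mult mult_ac)
  qed
qed

text \<open>Inflection points are zeros of a nonzero entire function, hence isolated. For a
  bitangent whose contact points \<open>x\<close> and \<open>y\<close> are not inflections, a change
  \<delta> of slope changes the intercept by about \<open>- x * \<delta>\<close> and by about
  \<open>- y * \<delta>\<close>; both cannot hold for a nearby pair, so the pairs are isolated as
  well.\<close>

lemma countable_special_slopes:
  assumes U: "entire_fps (U::'a fps)" "fps_deriv (fps_deriv U) \<noteq> 0"
    and D: "countable D" "closure D = (UNIV :: 'a set)"
  shows "countable (special_slopes U)"
proof -
  let ?D = "ev (fps_deriv U)" and ?DD = "ev (fps_deriv (fps_deriv U))"
  let ?c = "\<lambda>x. ev U x - x * ?D x"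
  have "countable {x. ?DD x = 0}"
  proof (rule countable_isolated[OF D])
    fix x assume "x \<in> {x. ?DD x = 0}"
    have "eventually (\<lambda>y. ?DD y \<noteq> 0) (at x)"
      using U by (intro eventually_ev_neq_0) auto
    then obtain d where "d > 0" "\<And>y. y \<noteq> x \<Longrightarrow> dist y x < d \<Longrightarrow> ?DD y \<noteq> 0"
      by (auto simp: eventually_at)
    thus "\<exists>d>0. \<forall>y\<in>{x. ?DD x = 0}. dist x y < d \<longrightarrow> y = x"
      by (intro exI[of _ d]) (auto simp: dist_commute)
  qed
  hence 1: "countable (?D ` {x. ?DD x = 0})" by (rule countable_image)
  define E where "E = {(x, y). x \<noteq> y \<and> ?D x = ?D y \<and> ?c x = ?c y \<and> ?DD x \<noteq> 0 \<and> ?DD y \<noteq> 0}"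
  have "countable E"
  proof (rule countable_isolated)
    show "countable (D \<times> D)" using D by auto
    show "closure (D \<times> D) = UNIV" using D by (simp add: closure_Times)
    fix p assume "p \<in> E"
    then obtain x y where p: "p = (x, y)" and xy: "x \<noteq> y" "?D x = ?D y" "?c x = ?c y" "?DD x \<noteq> 0" "?DD y \<noteq> 0"
      by (auto simp: E_def)
    \<comment> \<open>The two estimates with error below \<open>e * absval \<delta>\<close> subtract
      to \<open>absval ((x - y) * \<delta>) < e * absval \<delta>\<close>, which is impossible for
      this \<open>e\<close>.\<close>
    define e where "e = absval (x - y)"
    have e: "e > 0" using xy by (simp add: e_def)
    obtain d1 where d1: "d1 > 0" "\<And>x'. x' \<noteq> x \<Longrightarrow> dist x' x < d1 \<Longrightarrow> ?D x' \<noteq> ?D x \<and>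
        absval (?c x' - ?c x + x * (?D x' - ?D x)) < e * absval (?D x' - ?D x)"
      using intercept_near[OF U(1) xy(4) e] by (auto simp: eventually_at)
    obtain d2 where d2: "d2 > 0" "\<And>y'. y' \<noteq> y \<Longrightarrow> dist y' y < d2 \<Longrightarrow> ?D y' \<noteq> ?D y \<and>
        absval (?c y' - ?c y + y * (?D y' - ?D y)) < e * absval (?D y' - ?D y)"
      using intercept_near[OF U(1) xy(5) e] by (auto simp: eventually_at)
    show "\<exists>d>0. \<forall>q\<in>E. dist p q < d \<longrightarrow> q = p"
    proof (intro exI[of _ "min d1 d2"] conjI ballI impI)
      fix q assume q: "q \<in> E" "dist p q < min d1 d2"
      obtain x' y' where q': "q = (x', y')" by force
      with q have E: "?D x' = ?D y'" "?c x' = ?c y'" by (auto simp: E_def)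
      have dist: "dist x' x < d1" "dist y' y < d2"
        using dist_fst_le[of p q] dist_snd_le[of p q] q(2) by (auto simp: p q' dist_commute)
      define \<delta> where "\<delta> = ?D x' - ?D x"
      have \<delta>': "?D y' - ?D y = \<delta>" "?c y' - ?c y = ?c x' - ?c x" using E xy by (simp_all add: \<delta>_def)
      have "x' = x \<and> y' = y"
      proof (rule ccontr)
        assume neg: "\<not> (x' = x \<and> y' = y)"
        \<comment> \<open>Near \<open>x\<close> and near \<open>y\<close> the slope determines the
          point, so an unchanged slope would leave both contact points in place.\<close>
        have "\<delta> \<noteq> 0"
          using neg d1(2)[of x'] d2(2)[of y'] dist \<delta>' unfolding \<delta>_def by (metis eq_iff_diff_eq_0)
        hence ne: "x' \<noteq> x" "y' \<noteq> y" using \<delta>' by (auto simp: \<delta>_def)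
        have "absval (?c x' - ?c x + x * \<delta>) < e * absval \<delta>"
          using d1(2)[OF ne(1) dist(1)] by (simp add: \<delta>_def)
        moreover have "absval (?c x' - ?c x + y * \<delta>) < e * absval \<delta>"
          using d2(2)[OF ne(2) dist(2)] by (simp only: \<delta>')
        ultimately have "absval ((?c x' - ?c x + x * \<delta>) - (?c x' - ?c x + y * \<delta>)) < e * absval \<delta>"
          by (rule absval_diff_less)
        also have "(?c x' - ?c x + x * \<delta>) - (?c x' - ?c x + y * \<delta>) = (x - y) * \<delta>"
          by (simp add: algebra_simps)
        finally show False by (simp add: e_def absval_mult)
      qed
      thus "q = p" by (simp add: p q')
    qed (use d1 d2 in auto)
  qed
  hence 2: "countable ((?D \<circ> fst) ` E)" by (rule countable_image)
  have "special_slopes U \<subseteq> ?D ` {x. ?DD x = 0} \<union> (?D \<circ> fst) ` E"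
  proof
    fix a assume "a \<in> special_slopes U"
    then consider x where "a = ?D x" "?DD x = 0" | x y where "a = ?D x" "(x, y) \<in> E"
      unfolding special_slopes_def E_def by blast
    thus "a \<in> ?D ` {x. ?DD x = 0} \<union> (?D \<circ> fst) ` E"
    proof cases
      case (2 x y)
      hence "a = (?D \<circ> fst) (x, y)" by simp
      thus ?thesis using 2(2) by blast
    qed auto
  qed
  thus ?thesis using 1 2 by (meson countable_Un countable_subset)
qed

text \<open>At a critical value of the outer function, the composite differs from \<open>c\<close>
  by a multiple of the square of \<open>H - b\<close>, so the line has contact of order at least two
  at \<open>w\<close>. A multiple zero of \<open>H - b\<close>, that is \<open>ev M w = 0\<close>,
  gives higher contact. The composite with \<open>K\<close> enters only through its limit at
  \<open>w\<close>, so no composite series is formed.\<close>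

lemma critical_value_tangent:
  assumes U: "entire_fps (U::'a fps)" and H: "entire_fps H" and K: "entire_fps K" and M: "entire_fps M"
    and comp: "\<And>x. ev U x - a * x = c + (ev H x - b)\<^sup>2 * ev K (ev H x)"
    and HL: "\<And>x. ev H x = b + (x - w) * ev M x"
  shows "ev (fps_deriv U) w = a" "ev U w - w * a = c"
    "ev M w = 0 \<Longrightarrow> ev (fps_deriv (fps_deriv U)) w = 0"
proof -
  obtain Q where Q: "entire_fps Q"
    "\<And>x. ev U x = ev U w + (x - w) * ev (fps_deriv U) w + (x - w)\<^sup>2 * ev Q x"
    "ev (fps_deriv (fps_deriv U)) w = 2 * ev Q w"
    using taylor2[OF U, of w] by metis
  show c: "ev U w - w * a = c" using comp[of w] HL[of w] by (simp add: mult_ac)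
  have Hlim: "(ev H \<longlongrightarrow> b) (at w)" using H HL[of w] by (intro ev_tendsto_at) auto
  have KH: "((\<lambda>x. ev K (ev H x)) \<longlongrightarrow> ev K b) (at w)"
    using isCont_tendsto_compose[OF _ Hlim, of "ev K"] isCont_ev[OF K] by (simp add: isCont_def)
  have Llim: "(ev M \<longlongrightarrow> ev M w) (at w)" and Qlim: "(ev Q \<longlongrightarrow> ev Q w) (at w)"
    using M Q(1) by (auto intro: isCont_ev)
  \<comment> \<open>Equate the second-order expansion of \<open>U\<close> with the composite and
    divide by \<open>x - w\<close>; then let \<open>x\<close> tend to \<open>w\<close>.\<close>
  have eq: "ev (fps_deriv U) w - a = (x - w) * ((ev M x)\<^sup>2 * ev K (ev H x) - ev Q x)" if "x \<noteq> w" for x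
  proof -
    have "ev U w + (x - w) * ev (fps_deriv U) w + (x - w)\<^sup>2 * ev Q x - a * x
        = ev U w - w * a + ((x - w) * ev M x)\<^sup>2 * ev K (ev H x)"
      using comp[of x] Q(2)[of x] HL[of x] c by simp
    hence "(x - w) * (ev (fps_deriv U) w - a)
        = (x - w) * ((x - w) * ((ev M x)\<^sup>2 * ev K (ev H x) - ev Q x))"
      by (simp add: algebra_simps power2_eq_square)
    thus ?thesis using that by simp
  qed
  have lim1: "((\<lambda>x. (x - w) * ((ev M x)\<^sup>2 * ev K (ev H x) - ev Q x)) \<longlongrightarrow>
      (w - w) * ((ev M w * ev M w) * ev K b - ev Q w)) (at w)"
    unfolding power2_eq_square
    by (intro tendsto_mult tendsto_diff Llim Qlim KH tendsto_ident_at tendsto_const)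
  have "eventually (\<lambda>x. (x - w) * ((ev M x)\<^sup>2 * ev K (ev H x) - ev Q x) = ev (fps_deriv U) w - a) (at w)"
    using eventually_neq_at[of w] by eventually_elim (simp add: eq)
  from tendsto_cong[OF this] lim1
  have "((\<lambda>x. ev (fps_deriv U) w - a) \<longlongrightarrow> 0) (at w)" by simp
  from tendsto_unique[OF at_neq_bot this tendsto_const] show a: "ev (fps_deriv U) w = a" by simp
  assume L0: "ev M w = 0"
  have lim2: "((\<lambda>x. (ev M x)\<^sup>2 * ev K (ev H x) - ev Q x) \<longlongrightarrow>
      (ev M w * ev M w) * ev K b - ev Q w) (at w)"
    unfolding power2_eq_square by (intro tendsto_mult tendsto_diff Llim Qlim KH)
  have "eventually (\<lambda>x. (ev M x)\<^sup>2 * ev K (ev H x) - ev Q x = 0) (at w)"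
    using eventually_neq_at[of w] by eventually_elim (use eq a in auto)
  from tendsto_cong[OF this] lim2
  have "((\<lambda>x. 0) \<longlongrightarrow> - ev Q w) (at w)" using L0 by simp
  from tendsto_unique[OF at_neq_bot this tendsto_const] show "ev (fps_deriv (fps_deriv U)) w = 0"
    using Q(3) by simp
qed

lemma entire_composition_affine:
  assumes U: "entire_fps (U::'a fps)" and G: "entire_fps G" and H: "entire_fps H"
    and comp: "\<And>x. ev U x - a * x = ev G (ev H x)"
    and a: "a \<notin> special_slopes U"
    and H_nonconst: "n > 0" "H $ n \<noteq> 0"
  shows "(\<forall>n\<ge>2. G $ n = 0) \<or> (\<forall>n\<ge>2. H $ n = 0)"
proof (rule disjCI)
  assume "\<not> (\<forall>n\<ge>2. H $ n = 0)"
  show "\<forall>n\<ge>2. G $ n = 0"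
  proof (rule ccontr)
    assume "\<not> (\<forall>n\<ge>2. G $ n = 0)"
    then obtain k where k: "k \<ge> 2" "G $ k \<noteq> 0" by blast
    \<comment> \<open>As \<open>k - 1 \<ge> 1\<close> and the characteristic is 0, the derivative of
      \<open>G\<close> is nonconstant and so has a zero.\<close>
    hence "fps_deriv G $ (k - 1) \<noteq> 0" by simp
    then obtain b where b: "ev (fps_deriv G) b = 0"
      using ev_surj[OF entire_fps_deriv[OF G], of "k - 1" 0] k by auto
    obtain K where K: "entire_fps K" "\<And>y. ev G y = ev G b + (y - b)\<^sup>2 * ev K y"
      using taylor2[OF G, of b] b by auto
    have tangent: "ev (fps_deriv U) w = a" "ev U w - w * a = ev G b"
        "ev (fps_deriv (fps_deriv U)) w \<noteq> 0" "\<And>M. entire_fps M \<Longrightarrow>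
          (\<And>x. ev H x = b + (x - w) * ev M x) \<Longrightarrow> ev M w \<noteq> 0" if w: "ev H w = b" for w
    proof -
      obtain M where M: "entire_fps M" "\<And>x. ev H x = b + (x - w) * ev M x"
        using ev_remainder_deriv[OF H, of w] unfolding w by blast
      have *: "ev U x - a * x = ev G b + (ev H x - b)\<^sup>2 * ev K (ev H x)" for x
        unfolding comp by (rule K(2))
      note t = critical_value_tangent[OF U H K(1) _ *]
      show 1: "ev (fps_deriv U) w = a" by (rule t(1)[OF M])
      show "ev U w - w * a = ev G b" by (rule t(2)[OF M])
      show 2: "ev (fps_deriv (fps_deriv U)) w \<noteq> 0" using a 1 by (auto simp: special_slopes_def)
      show "ev M w \<noteq> 0" if "entire_fps M" "\<And>x. ev H x = b + (x - w) * ev M x" for M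
        using t(3)[OF that] 2 by blast
    qed
    obtain w where w: "ev H w = b" using ev_surj[OF H H_nonconst] by blast
    have unique: "x = w" if x: "ev H x = b" for x
    proof (rule ccontr)
      assume "x \<noteq> w"
      hence "ev (fps_deriv U) x \<in> special_slopes U"
        using tangent(1-3)[OF x] tangent(1-3)[OF w] unfolding special_slopes_def by fastforce
      thus False using a tangent(1)[OF x] by simp
    qed
    obtain M where M: "entire_fps M" "H = fps_const b + (fps_X - fps_const w) * M"
        "\<And>x. ev H x = b + (x - w) * ev M x"
      using ev_remainder_deriv[OF H, of w] unfolding w by blast
    \<comment> \<open>At \<open>w\<close> because the zero of \<open>H - b\<close> is simple,
      elsewhere because it is the only one.\<close>
    have "ev M x \<noteq> 0" for x
      using tangent(4)[OF w M(1,3)] unique[of x] M(3)[of x] by (cases "x = w") auto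
    hence "M = fps_const (M $ 0)" using zero_free_const M(1) by blast
    then obtain l where l: "M = fps_const l" by blast
    have "H $ n = 0" if "n \<ge> 2" for n
      using that unfolding M(2) l by (cases n) (auto simp: fps_linear_nth)
    thus False using \<open>\<not> (\<forall>n\<ge>2. H $ n = 0)\<close> by blast
  qed
qed

end

section \<open>Factorizations into meromorphic functions\<close>

definition affine_fps :: "'a::zero fps \<Rightarrow> bool" where
  "affine_fps U \<longleftrightarrow> (\<forall>n\<ge>2. U $ n = 0)"

section \<open>Separability of the field\<close>

context dense_alg_closed
begin

text \<open>Continuity of roots: an element of \<open>L\<close> is a root of a polynomial over the
  closure of the rationals, and a rational polynomial close to it in the Gauss norm has a root close
  to that element.\<close>

lemma countable_dense_subset:
  assumes rat: "closure (range of_rat) \<subseteq> L"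
    and alg: "\<And>x. x \<in> L \<Longrightarrow> algebraic_over (closure (range of_rat)) x"
  shows "\<exists>D. countable D \<and> closure D = (UNIV :: 'a set)"
proof -
  define D :: "'a set" where "D = (\<Union>xs\<in>{xs :: rat list. Poly (map of_rat xs :: 'a list) \<noteq> 0}.
    {x. poly (Poly (map of_rat xs)) x = 0})"
  have "countable D"
    unfolding D_def 
    by (intro countable_UN[OF countable_subset[OF subset_UNIV countableI_type]]
      countable_finite poly_roots_finite) auto
  moreover have "x \<in> closure D" for x
    unfolding closure_approachable
  proof (intro allI impI)
    fix e :: real assume e: "0 < e"
    obtain x' where x': "x' \<in> L" "dist x' x < e" using dense e by (metis UNIV_I closure_approachable)
    obtain P where P: "P \<noteq> 0" "\<And>i. coeff P i \<in> closure (range of_rat)" "poly P x' = 0"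
      using alg[OF x'(1)] unfolding algebraic_over_def by blast
    define r where "r = absval x' + 1"
    have r: "r > 0" "absval x' \<le> r" by (simp_all add: r_def add_nonneg_pos)
    have "fps_of_poly P \<noteq> 0" using P(1) by simp
    then obtain N where N: "dominant r N (fps_of_poly P)"
      using dominant_exists[OF entire_fps_of_poly _ r(1)] by blast
    define c where "c = absval (coeff P N)"
    have c: "c > 0" using N by (simp add: c_def dominant_def)
    \<comment> \<open>The first bound preserves the dominant index; the second brings the value at
      \<open>x'\<close> below the threshold \<open>c * e ^ N\<close> of
      \<open>near_root_poly\<close>.\<close>
    define \<epsilon> where "\<epsilon> = min (c * r ^ N) (c * e ^ N / 2)"
    have \<epsilon>: "\<epsilon> > 0" using c r e by (simp add: \<epsilon>_def)
    have "(0::'a) \<in> range of_rat" by (metis of_rat_0 rangeI)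
    then obtain R where R: "\<And>i. coeff R i \<in> range of_rat"
      "\<And>n. absval (coeff R n - coeff P n) * r ^ n < \<epsilon>"
      using approx_by_poly[OF entire_fps_of_poly[of P] r(1) \<epsilon>, of "range of_rat"] P(2) by auto
    have *: "absval (fps_of_poly R $ n - fps_of_poly P $ n) * r ^ n < absval (fps_of_poly P $ N) * r ^ N" for n
      using R(2)[of n] by (simp add: \<epsilon>_def c_def)
    have "absval (poly R x') \<le> \<epsilon>"
      using ev_le[of "fps_of_poly R - fps_of_poly P" x' r \<epsilon>] R(2) P(3) r by (simp add: less_imp_le)
    also have "\<dots> \<le> c * e ^ N / 2" by (simp add: \<epsilon>_def)
    also have "\<dots> < c * e ^ N" using c e by simp
    also have "c = absval (coeff R N)" using dominant_perturb(2)[OF N r(1) *] by (simp add: c_def)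
    finally have less: "absval (poly R x') < absval (coeff R N) * e ^ N" .
    have RL: "coeff R i \<in> L" for i using R(1) rat closure_subset by blast
    obtain w where w: "poly R w = 0" "absval (x' - w) < e"
      using near_root_poly[OF RL dominant_perturb(1)[OF N r(1) *] r _ less] e by auto
    have "set (coeffs R) \<subseteq> range of_rat" using R(1) by (auto simp: coeffs_def)
    then obtain xs :: "rat list" where "map of_rat xs = coeffs R"
      by (metis ex_map_conv rangeE subsetD)
    hence xs: "Poly (map of_rat xs) = R" by simp
    have "coeff R N \<noteq> 0" using less by (metis absval_0 absval_nonneg mult_zero_left not_less)
    hence "R \<noteq> 0" by auto
    hence "w \<in> D" unfolding D_def using xs w(1) by auto
    moreover have "absval (w - x) < e"
      using absval_add_less[of "w - x'" e "x' - x"] w(2) x'(2)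
      by (simp add: dist_absval absval_minus_commute)
    ultimately show "\<exists>y\<in>D. dist y x < e" by (auto simp: dist_absval)
  qed
  ultimately show ?thesis by auto
qed

text \<open>Solving \<open>S / T = y\<close> amounts to finding a zero of \<open>T - S / y\<close>.
  For large \<open>y\<close> this is a small perturbation of \<open>T\<close>, which vanishes at
  \<open>x0\<close>, so \<open>near_root\<close> puts a zero near \<open>x0\<close>.\<close>

lemma values_near_pole:
  assumes S: "entire_fps (S::'a fps)" and T: "entire_fps T" "T \<noteq> 0"
    and x0: "ev T x0 = 0" "ev S x0 \<noteq> 0" and \<rho>: "\<rho> > 0"
  shows "\<exists>R. \<forall>y. absval y > R \<longrightarrow> (\<exists>x. absval (x - x0) < \<rho> \<and> fraction_value (ev S) (ev T) x = Some y)"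
proof -
  have "eventually (\<lambda>x. ev S x \<noteq> 0) (at x0)"
    using isCont_ev[OF S] x0(2) by (rule tendsto_imp_eventually_nz)
  then obtain d where d: "d > 0" "\<And>x. x \<noteq> x0 \<Longrightarrow> dist x x0 < d \<Longrightarrow> ev S x \<noteq> 0"
    by (auto simp: eventually_at)
  \<comment> \<open>Staying within \<open>d\<close> keeps \<open>S\<close> nonzero, so the zero
    found is not a common zero of \<open>S\<close> and \<open>T\<close>.\<close>
  define t where "t = min \<rho> d"
  have t: "t > 0" using \<rho> d by (simp add: t_def)
  define r where "r = absval x0 + 1"
  have r: "r > 0" "absval x0 \<le> r" by (simp_all add: r_def add_nonneg_pos)
  obtain N where N: "dominant r N T" using dominant_exists[OF T r(1)] .
  define c where "c = absval (T $ N)"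
  have c: "c > 0" using N by (simp add: c_def dominant_def)
  obtain B where B: "0 < B" "\<And>n. absval (S $ n) * r ^ n \<le> B" using entire_fpsD[OF S r(1)] by blast
  show ?thesis
  \<comment> \<open>The first threshold preserves the dominant index of \<open>T\<close>; the second
    makes the perturbed series small enough at \<open>x0\<close> for
    \<open>near_root\<close>.\<close>
  proof (intro exI[of _ "max (B / (c * r ^ N)) (absval (ev S x0) / (c * t ^ N))"] allI impI)
    fix y :: 'a assume y: "max (B / (c * r ^ N)) (absval (ev S x0) / (c * t ^ N)) < absval y"
    have "0 < B / (c * r ^ N)" using B(1) c r by simp
    hence y0: "absval y > 0" using y unfolding max_less_iff_conj by linarith
    define V where "V = T - fps_const (inverse y) * S"
    have V: "entire_fps V" using S T by (simp add: V_def)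
    have *: "absval (V $ n - T $ n) * r ^ n < absval (T $ N) * r ^ N" for n
    proof -
      have "absval (V $ n - T $ n) * r ^ n = (absval (S $ n) * r ^ n) / absval y"
        by (simp add: V_def absval_mult divide_inverse mult_ac)
      also have "\<dots> \<le> B / absval y" using B(2)[of n] by (intro divide_right_mono) auto
      also have "\<dots> < c * r ^ N" using y y0 c r by (simp add: field_simps)
      finally show ?thesis by (simp add: c_def)
    qed
    have "absval (ev V x0) = absval (ev S x0) / absval y"
      using S T x0(1) by (simp add: V_def absval_mult divide_inverse mult_ac)
    also have "\<dots> < c * t ^ N" using y y0 c t by (simp add: field_simps)
    also have "c = absval (V $ N)" using dominant_perturb(2)[OF N r(1) *] by (simp add: c_def)
    finally have "\<exists>w. ev V w = 0 \<and> absval w \<le> r \<and> absval (x0 - w) < t"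
      using t by (intro near_root[OF V dominant_perturb(1)[OF N r(1) *] r]) auto
    then obtain w where w: "ev V w = 0" "absval (w - x0) < t" by (auto simp: absval_minus_commute)
    have Tw: "ev T w = ev S w / y" using w(1) S T by (simp add: V_def divide_inverse mult.commute)
    have Sw: "ev S w \<noteq> 0"
      using d(2)[of w] w(2) x0(2) by (cases "w = x0") (auto simp: t_def dist_absval)
    have "fraction_value (ev S) (ev T) w = Some (ev S w / ev T w)"
      by (rule fraction_value_Some[OF S T(1)]) (use Sw Tw y0 in auto)
    also have "ev S w / ev T w = y" using Tw Sw by simp
    finally show "\<exists>x. absval (x - x0) < \<rho> \<and> fraction_value (ev S) (ev T) x = Some y"
      using w(2) by (auto simp: t_def)
  qed
qed

section \<open>Liouville theorems\<close>

lemma liouville: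
  assumes "entire_fps (U::'a fps)" "\<And>x. absval (ev U x) \<le> B"
  shows "U = fps_const (U $ 0)"
proof (rule fps_ext)
  fix n
  obtain y :: 'a where y: "absval y > B" using large_element by blast
  show "U $ n = fps_const (U $ 0) $ n"
  proof (cases "n = 0")
    case False
    have "U $ n = 0"
    proof (rule ccontr)
      assume "U $ n \<noteq> 0"
      then obtain x where "ev U x = y" using ev_surj[OF assms(1)] False by blast
      thus False using assms(2)[of x] y by simp
    qed
    thus ?thesis using False by simp
  qed simp
qed

lemma liouville_at_infinity:
  assumes U: "entire_fps (U::'a fps)" and B: "\<And>x. absval x > R \<Longrightarrow> absval (ev U x) \<le> B"
  shows "U = fps_const (U $ 0)"
proof -
  obtain C where C: "\<And>n. absval (U $ n) * (max R 1) ^ n \<le> C"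
    using entire_fpsD[OF U, of "max R 1"] by (metis less_max_iff_disj zero_less_one)
  show ?thesis
  proof (rule liouville[OF U])
    fix x
    show "absval (ev U x) \<le> max B C"
      using B[of x] ev_le[OF U, of x "max R 1" C] C by (cases "absval x > R") (auto simp: le_max_iff_disj)
  qed
qed

lemma ev_affine:
  assumes "\<forall>n\<ge>2. (U::'a fps) $ n = 0"
  shows "ev U x = U $ 0 + U $ 1 * x"
proof -
  have "U = fps_of_poly [:U $ 0, U $ 1:]"
  proof (rule fps_ext)
    fix n
    show "U $ n = fps_of_poly [:U $ 0, U $ 1:] $ n"
    proof (cases "n \<ge> 2")
      case True
      hence "coeff [:U $ 0, U $ 1:] n = 0" by (intro coeff_eq_0) (simp add: degree_pCons_eq_if)
      thus ?thesis using True assms by simp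
    next
      case False
      hence "n = 0 \<or> n = 1" by auto
      thus ?thesis by auto
    qed
  qed
  hence "ev U x = poly [:U $ 0, U $ 1:] x" by (metis ev_of_poly)
  thus ?thesis by (simp add: mult.commute)
qed

lemma poly_compose_entire:
  assumes "entire_fps (H::'a fps)"
  shows "\<exists>K. entire_fps K \<and> (\<forall>x. ev K x = poly P (ev H x))"
proof (induction P)
  case 0
  show ?case by (intro exI[of _ 0]) simp
next
  case (pCons a P)
  then obtain K where "entire_fps K" "\<And>x. ev K x = poly P (ev H x)" by blast
  thus ?case using assms by (intro exI[of _ "fps_const a + H * K"]) simp
qed

text \<open>Repeated division by \<open>y - b\<close> separates the principal part at
  \<open>b\<close>, a polynomial in \<open>1 / (y - b)\<close>, from an entire remainder.\<close>

lemma polar_part: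
  assumes "entire_fps (W::'a fps)"
  shows "\<exists>P R. entire_fps R \<and> (\<forall>y. y \<noteq> b \<longrightarrow> ev W y / (y - b) ^ k = poly P (1 / (y - b)) + ev R y)"
  using assms
proof (induction k arbitrary: W)
  case 0
  thus ?case by (intro exI[of _ 0] exI[of _ W]) simp
next
  case (Suc k)
  obtain Q where Q: "entire_fps Q" "W = fps_const (ev W b) + (fps_X - fps_const b) * Q"
    using ev_remainder[OF Suc.prems] .
  obtain P R where P: "entire_fps R" "\<And>y. y \<noteq> b \<Longrightarrow> ev Q y / (y - b) ^ k = poly P (1 / (y - b)) + ev R y"
    using Suc.IH[OF Q(1)] by blast
  show ?case
  proof (intro exI[of _ "P + monom (ev W b) (Suc k)"] exI[of _ R] conjI allI impI P(1))
    fix y assume y: "y \<noteq> b"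
    have "ev W y = ev W b + (y - b) * ev Q y"
      using arg_cong[OF Q(2), of "\<lambda>V. ev V y"] Q(1) by simp
    hence "ev W y / (y - b) ^ Suc k = ev W b * (1 / (y - b)) ^ Suc k + ev Q y / (y - b) ^ k"
      unfolding \<open>ev W y = _\<close> add_divide_distrib using y by (simp add: power_one_over)
    thus "ev W y / (y - b) ^ Suc k = poly (P + monom (ev W b) (Suc k)) (1 / (y - b)) + ev R y"
      using P(2)[OF y] by (simp add: poly_monom)
  qed
qed

text \<open>Multiplication by \<open>T\<close> extends the identity across its zeros. It is needed
  because a composition is unconstrained at the poles of the inner function.\<close>

lemma const_if_const_off_zeros:
  assumes "entire_fps (F::'a fps)" "entire_fps K" "entire_fps T" "T \<noteq> 0"
    "\<And>x. ev T x \<noteq> 0 \<Longrightarrow> ev F x = ev K x"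
  shows "F = K"
proof -
  have "(F - K) * T = 0"
  proof (rule ev_eq_0_imp)
    show "ev ((F - K) * T) x = 0" for x using assms(1-3) assms(5)[of x] by auto
  qed (use assms in simp)
  thus ?thesis using assms(4) by simp
qed

text \<open>\<open>affine_fps\<close> includes constant series, which are not linear rational; the
  last assumption excludes them.\<close>

lemma linear_rational_affine:
  assumes "affine_fps (U::'a fps)" "\<And>x. f x = Some (ev U x)" "U \<noteq> fps_const (U $ 0)"
  shows "linear_rational f"
proof -
  have U1: "U $ 1 \<noteq> 0"
  proof
    assume U1: "U $ 1 = 0"
    have "U $ n = fps_const (U $ 0) $ n" for n
      using assms(1) U1 by (cases "n \<ge> 2"; cases "n = 0"; cases "n = 1") (auto simp: affine_fps_def)
    thus False using assms(3) fps_ext by blast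
  qed
  show ?thesis unfolding linear_rational_def
    by (rule exI[of _ "U $ 1"], rule exI[of _ "U $ 0"], rule exI[of _ 0], rule exI[of _ 1])
      (use assms(1,2) U1 in \<open>simp add: affine_fps_def ev_affine add.commute\<close>)
qed

section \<open>From meromorphic to entire factorizations\<close>

lemma factors_without_pole:
  assumes F: "entire_fps (F::'a fps)" "F \<noteq> fps_const (F $ 0)"
    and S: "entire_fps S" "entire_fps T" "T \<noteq> 0" and U: "entire_fps U" "entire_fps V" "V \<noteq> 0"
    and comp: "\<And>x y. fraction_value (ev S) (ev T) x = Some y \<Longrightarrow> fraction_value (ev U) (ev V) y = Some (ev F x)"
    and np: "\<And>x. fraction_value (ev S) (ev T) x \<noteq> None"
  obtains G H n where "entire_fps G" "entire_fps H" "n > 0" "H $ n \<noteq> 0" "\<And>x. ev F x = ev G (ev H x)"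
    "affine_fps G \<Longrightarrow> linear_rational (fraction_value (ev U) (ev V))"
    "affine_fps H \<Longrightarrow> linear_rational (fraction_value (ev S) (ev T))"
proof -
  obtain H where H: "entire_fps H" "S = T * H" using entire_quotient[OF S np] .
  have h: "fraction_value (ev S) (ev T) x = Some (ev H x)" for x
    unfolding H(2) by (rule fraction_value_mult_left[OF S(2,3) H(1)])
  have F_nonconst: False if "\<And>x. ev F x = c" for c
  proof -
    have "F = fps_const c" by (rule ev_eq_imp) (use F that in auto)
    thus False using F(2) by simp
  qed
  have Hn: "H \<noteq> fps_const (H $ 0)"
  proof
    assume "H = fps_const (H $ 0)"
    hence "ev H x = H $ 0" for x by (metis ev_const)
    hence "Some (ev F x) = Some (ev F 0)" for x using comp[OF h, of x] comp[OF h, of 0] by simp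
    thus False using F_nonconst by blast
  qed
  then obtain n where n: "H $ n \<noteq> fps_const (H $ 0) $ n" by (meson fps_ext)
  hence n': "n > 0" "H $ n \<noteq> 0" by (auto intro!: gr0I split: if_splits)
  \<comment> \<open>\<open>H\<close> takes every value \<open>y\<close>, and at such a value the
    outer function equals a value of \<open>F\<close>, which is finite.\<close>
  have "fraction_value (ev U) (ev V) y \<noteq> None" for y
    using ev_surj[OF H(1) n', of y] comp[OF h] by auto
  then obtain G where G: "entire_fps G" "U = V * G" using entire_quotient[OF U] by blast
  have g: "fraction_value (ev U) (ev V) x = Some (ev G x)" for x
    unfolding G(2) by (rule fraction_value_mult_left[OF U(2,3) G(1)])
  have FGH: "ev F x = ev G (ev H x)" for x using comp[OF h, of x] g by simp
  have Gn: "G \<noteq> fps_const (G $ 0)"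
  proof
    assume "G = fps_const (G $ 0)"
    hence "ev G x = G $ 0" for x by (metis ev_const)
    thus False using F_nonconst FGH by simp
  qed
  show thesis
    by (rule that[OF G(1) H(1) n' FGH]) (use linear_rational_affine g h Gn Hn in blast)+
qed

text \<open>The Moebius map \<open>y \<mapsto> 1 / (y - b)\<close> is absorbed into both factors,
  which makes them entire. Moebius maps preserve linear rational functions, so the last two
  conclusions carry over to the original factors.\<close>

lemma factors_with_pole:
  assumes F: "entire_fps (F::'a fps)" "F \<noteq> fps_const (F $ 0)"
    and S: "entire_fps S" "entire_fps T" "T \<noteq> 0" and U: "entire_fps U" "entire_fps V" "V \<noteq> 0"
    and comp: "\<And>x y. fraction_value (ev S) (ev T) x = Some y \<Longrightarrow> fraction_value (ev U) (ev V) y = Some (ev F x)"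
    and pole: "fraction_value (ev S) (ev T) x0 = None"
  obtains G H n where "entire_fps G" "entire_fps H" "n > 0" "H $ n \<noteq> 0" "\<And>x. ev F x = ev G (ev H x)"
    "affine_fps G \<Longrightarrow> linear_rational (fraction_value (ev U) (ev V))"
    "affine_fps H \<Longrightarrow> linear_rational (fraction_value (ev S) (ev T))"
proof -
  define g where "g = fraction_value (ev U) (ev V)"
  define h where "h = fraction_value (ev S) (ev T)"
  have comp: "g y = Some (ev F x)" if "h x = Some y" for x y using comp that by (simp add: g_def h_def)
  have F_nonconst: False if "F = fps_const c" for c using F(2) that by simp
  obtain W S1 T1 where W: "entire_fps W" "W \<noteq> 0" "S = W * S1" "T = W * T1"
    and S1: "entire_fps S1" and T1: "entire_fps T1" "T1 \<noteq> 0" and cop: "ev S1 x0 \<noteq> 0 \<or> ev T1 x0 \<noteq> 0"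
    using cancel_at[OF S] by metis
  have h1: "h = fraction_value (ev S1) (ev T1)"
    by (rule ext) (simp add: h_def W fraction_value_mult S1 T1)
  have "fraction_value (ev S1) (ev T1) x0 = None" using pole by (simp flip: h_def h1)
  hence T1x0: "ev T1 x0 = 0" using fraction_value_Some[OF S1 T1(1)] by (metis option.distinct(1))
  hence S1x0: "ev S1 x0 \<noteq> 0" using cop by simp

  obtain R where R: "\<And>y. absval y > R \<Longrightarrow> \<exists>x. absval (x - x0) < 1 \<and> h x = Some y"
    using values_near_pole[OF S1 T1 T1x0 S1x0 zero_less_one] by (auto simp: h1)
  define r where "r = absval x0 + 1"
  have r: "r > 0" by (simp add: r_def add_nonneg_pos)
  obtain B where B: "0 < B" "\<And>n. absval (F $ n) * r ^ n \<le> B" using entire_fpsD[OF F(1) r] by blast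
  have bounded: "\<exists>z. g y = Some z \<and> absval z \<le> B" if y: "absval y > R" for y
  proof -
    obtain x where x: "absval (x - x0) < 1" "h x = Some y" using R[OF y] by blast
    have "absval x \<le> r"
      using absval_add_le[of "x - x0" r x0] x(1) absval_nonneg[of x0] by (simp add: r_def)
    from ev_le[OF F(1) this B(2)] show ?thesis using comp[OF x(2)] by blast
  qed

  obtain b where b: "g b = None"
  proof (rule ccontr)
    assume "\<not> thesis"
    hence "g y \<noteq> None" for y using that by blast
    then obtain G where G: "entire_fps G" "U = V * G"
      using entire_quotient[OF U] unfolding g_def by blast
    have g: "g x = Some (ev G x)" for x
      unfolding G(2) g_def by (rule fraction_value_mult_left[OF U(2,3) G(1)])
    have "G = fps_const (G $ 0)"
      by (rule liouville_at_infinity[OF G(1), of R B]) (use bounded g in force)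
    hence Gc: "ev G y = G $ 0" for y by (metis ev_const)
    have "F = fps_const (G $ 0)"
    proof (rule const_if_const_off_zeros[OF F(1) _ T1])
      fix x assume "ev T1 x \<noteq> 0"
      hence "h x = Some (ev S1 x / ev T1 x)" unfolding h1 by (rule fraction_value_Some[OF S1 T1(1)])
      from comp[OF this] show "ev F x = ev (fps_const (G $ 0)) x" by (simp add: g Gc)
    qed simp
    thus False by (rule F_nonconst)
  qed
  have omit: "h x \<noteq> Some b" for x using comp[of x b] b by auto

  define D where "D = S1 - fps_const b * T1"
  have D: "entire_fps D" using S1 T1 by (simp add: D_def)
  have S1D: "S1 = D + fps_const b * T1" by (simp add: D_def)
  have D0: "D \<noteq> 0"
  proof
    assume "D = 0"
    obtain x where x: "ev T1 x \<noteq> 0" using ev_eq_0_imp[OF T1(1)] T1(2) by blast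
    have "h x = Some (ev S1 x / ev T1 x)" unfolding h1 by (rule fraction_value_Some[OF S1 T1(1) x])
    thus False using omit[of x] x \<open>D = 0\<close> T1 by (simp add: S1D)
  qed
  \<comment> \<open>\<open>D / T1\<close> represents \<open>h - b\<close>. At a pole of its
    reciprocal \<open>h\<close> would take the omitted value \<open>b\<close>.\<close>
  have np: "fraction_value (ev T1) (ev D) x \<noteq> None" for x
  proof -
    obtain W A C where W: "entire_fps W" "W \<noteq> 0" and AC: "entire_fps A" "entire_fps C" "C \<noteq> 0"
      and eq: "T1 = W * A" "D = W * C" and cop: "ev A x \<noteq> 0 \<or> ev C x \<noteq> 0"
      using cancel_at[OF T1(1) D D0, of x] by metis
    have "ev C x \<noteq> 0"
    proof
      assume C0: "ev C x = 0"
      hence A0: "ev A x \<noteq> 0" using cop by simp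
      have "S1 = W * (C + fps_const b * A)" unfolding S1D eq by (simp add: algebra_simps)
      hence "h x = fraction_value (ev (C + fps_const b * A)) (ev A) x"
        unfolding h1 using W AC by (simp add: eq fraction_value_mult)
      also have "\<dots> = Some b" using fraction_value_Some[of "C + fps_const b * A" A x] AC A0 C0 by simp
      finally show False using omit by blast
    qed
    thus ?thesis using fraction_value_Some[OF AC(1,2)] W AC by (simp add: eq fraction_value_mult)
  qed
  obtain H where H: "entire_fps H" "T1 = D * H" using entire_quotient[OF T1(1) D D0 np] .
  have H0: "H \<noteq> 0" using H(2) T1(2) by auto
  have "S1 = D * (1 + fps_const b * H)" unfolding S1D by (simp add: H(2) algebra_simps)
  hence h2: "h x = fraction_value (ev (1 + fps_const b * H)) (ev H) x" for x
    unfolding h1 using D D0 H(1) by (simp add: H(2) fraction_value_mult)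
  have h_Some: "h x = Some (b + 1 / ev H x)" if "ev H x \<noteq> 0" for x
    using fraction_value_Some[of "1 + fps_const b * H" H x] H(1) that
    by (simp add: h2 add_divide_distrib add.commute)
  have h_None: "h x = None" if "ev H x = 0" for x
    using fraction_value_None[of "1 + fps_const b * H" H x] H(1) H0 that by (simp add: h2)

  have Hn: "H \<noteq> fps_const (H $ 0)"
  proof
    assume Hc: "H = fps_const (H $ 0)"
    hence "H $ 0 \<noteq> 0" using H0 by auto
    moreover have "ev H x = H $ 0" for x by (subst Hc) simp
    ultimately have "g (b + 1 / H $ 0) = Some (ev F x)" for x using comp[OF h_Some, of x] by simp
    hence "ev F x = ev F 0" for x by (metis option.inject)
    hence "F = fps_const (ev F 0)" by (intro ev_eq_imp F) auto
    thus False by (rule F_nonconst)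
  qed
  then obtain n where n: "H $ n \<noteq> fps_const (H $ 0) $ n" by (meson fps_ext)
  hence n': "n > 0" "H $ n \<noteq> 0" by (auto intro!: gr0I split: if_splits)

  \<comment> \<open>Since \<open>H\<close> is surjective, \<open>h = b + 1 / H\<close> takes every
    value other than \<open>b\<close>; hence \<open>g\<close> has no pole besides
    \<open>b\<close>.\<close>
  have g_Some: "g y \<noteq> None" if "y \<noteq> b" for y
  proof -
    obtain x where x: "ev H x = 1 / (y - b)" using ev_surj[OF H(1) n'] by blast
    thus ?thesis using comp[OF h_Some[of x]] that by simp
  qed
  \<comment> \<open>All of the pole at \<open>b\<close> is moved into the power of
    \<open>X - b\<close>, so that \<open>U / V1\<close> has no pole and is entire.\<close>
  obtain k V1 where V1: "entire_fps V1" "V = (fps_X - fps_const b) ^ k * V1" "ev V1 b \<noteq> 0"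
    using order_at[OF U(2,3)] .
  have V1_0: "V1 \<noteq> 0" using V1(3) by auto
  have "fraction_value (ev U) (ev V1) y \<noteq> None" for y
  proof (cases "y = b")
    case True
    thus ?thesis using fraction_value_Some[OF U(1) V1(1)] V1(3) by simp
  next
    case False
    obtain W A C where W: "entire_fps W" "W \<noteq> 0" and AC: "entire_fps A" "entire_fps C" "C \<noteq> 0"
      and eq: "U = W * A" "V1 = W * C" and cop: "ev A y \<noteq> 0 \<or> ev C y \<noteq> 0"
      using cancel_at[OF U(1) V1(1) V1_0, of y] by metis
    have "V = W * ((fps_X - fps_const b) ^ k * C)" by (simp add: V1(2) eq mult_ac)
    hence "g y = fraction_value (ev A) (ev ((fps_X - fps_const b) ^ k * C)) y"
      unfolding g_def using W AC by (simp add: eq(1) fraction_value_mult)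
    hence "ev C y \<noteq> 0"
      using g_Some[OF False] cop AC X_minus_neq_0[of b]
        fraction_value_None[of A "(fps_X - fps_const b) ^ k * C" y] by auto
    thus ?thesis using fraction_value_Some[OF AC(1,2)] W AC by (simp add: eq fraction_value_mult)
  qed
  then obtain Z where Z: "entire_fps Z" "U = V1 * Z" using entire_quotient[OF U(1) V1(1) V1_0] by blast
  have g1: "g y = Some (ev Z y / (y - b) ^ k)" if "y \<noteq> b" for y
  proof -
    have "g y = fraction_value (ev Z) (ev ((fps_X - fps_const b) ^ k)) y"
      unfolding g_def Z(2) V1(2) mult.commute[of _ V1]
      by (rule fraction_value_mult) (use Z V1 V1_0 in auto)
    also have "\<dots> = Some (ev Z y / (y - b) ^ k)"
      using fraction_value_Some[of Z "(fps_X - fps_const b) ^ k" y] Z(1) that by simp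
    finally show ?thesis .
  qed
  obtain P Q where Q: "entire_fps Q"
    and PQ: "\<And>y. y \<noteq> b \<Longrightarrow> ev Z y / (y - b) ^ k = poly P (1 / (y - b)) + ev Q y"
    using polar_part[OF Z(1)] by blast
  obtain C where C: "\<And>n. absval (fps_of_poly P $ n) * 1 ^ n \<le> C"
    using entire_fpsD[OF entire_fps_of_poly zero_less_one] by blast
  \<comment> \<open>Near infinity \<open>g\<close> is bounded, and so is the principal part, since
    \<open>1 / (y - b)\<close> has absolute value at most 1 there. Their difference \<open>Q\<close>
    is therefore constant and can be added to the polynomial.\<close>
  have "Q = fps_const (Q $ 0)"
  proof (rule liouville_at_infinity[OF Q])
    fix y :: 'a assume y: "absval y > max R (absval b + 1)"
    have yb: "absval (y - b) \<ge> 1"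
    proof (rule ccontr)
      assume "\<not> absval (y - b) \<ge> 1"
      hence "absval y \<le> absval b + 1"
        using absval_add_le[of "y - b" "absval b + 1" b] absval_nonneg[of b] by simp
      thus False using y by simp
    qed
    hence ne: "y \<noteq> b" by auto
    have "absval (ev Z y / (y - b) ^ k) \<le> B" using bounded[of y] y g1[OF ne] by simp
    moreover have "absval (poly P (1 / (y - b))) \<le> C"
      using ev_le[OF entire_fps_of_poly _ C, of "1 / (y - b)"] yb ne by (simp add: absval_divide divide_le_eq_1)
    ultimately have "absval (ev Z y / (y - b) ^ k - poly P (1 / (y - b))) \<le> max B C"
      by (intro absval_diff_le) auto
    thus "absval (ev Q y) \<le> max B C" by (simp add: PQ[OF ne])
  qed
  hence Qc: "ev Q y = Q $ 0" for y by (metis ev_const)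
  define P' where "P' = P + [:Q $ 0:]"
  have g2: "g y = Some (poly P' (1 / (y - b)))" if "y \<noteq> b" for y
    using g1[OF that] PQ[OF that] by (simp add: P'_def Qc)

  obtain K where K: "entire_fps K" "\<And>x. ev K x = poly P' (ev H x)"
    using poly_compose_entire[OF H(1)] by blast
  have "F = K"
  proof (rule const_if_const_off_zeros[OF F(1) K(1) H(1) H0])
    fix x assume x: "ev H x \<noteq> 0"
    from comp[OF h_Some[OF x]] g2[of "b + 1 / ev H x"] x
    show "ev F x = ev K x" by (simp add: K(2))
  qed
  hence FGH: "ev F x = ev (fps_of_poly P') (ev H x)" for x by (simp add: K(2))

  show thesis
  proof (rule that[OF entire_fps_of_poly H(1) n' FGH])
    let ?G = "fps_of_poly P'"
    assume aff: "affine_fps ?G"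
    hence ev: "poly P' z = ?G $ 0 + ?G $ 1 * z" for z
      using ev_affine[of ?G z] by (simp add: affine_fps_def)
    have "?G $ 1 \<noteq> 0"
    proof
      assume "?G $ 1 = 0"
      hence "F = fps_const (?G $ 0)"
        by (intro ev_eq_imp F) (simp_all add: FGH ev)
      thus False by (rule F_nonconst)
    qed
    \<comment> \<open>The coefficients come from writing \<open>G0 + G1 / (y - b)\<close> over one
      denominator, with \<open>G0\<close>, \<open>G1\<close> the coefficients of
      \<open>?G\<close>.\<close>
    have "linear_rational g"
      unfolding linear_rational_def
    proof (rule exI[of _ "?G $ 0"], rule exI[of _ "?G $ 1 - ?G $ 0 * b"], rule exI[of _ 1],
        rule exI[of _ "- b"], intro conjI allI)
      show "?G $ 0 * - b - (?G $ 1 - ?G $ 0 * b) * 1 \<noteq> 0" using \<open>?G $ 1 \<noteq> 0\<close> by simp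
      show "g y = (if 1 * y + - b = 0 then None
          else Some ((?G $ 0 * y + (?G $ 1 - ?G $ 0 * b)) / (1 * y + - b)))" for y
        by (cases "y = b") (simp_all add: b g2 ev field_simps)
    qed
    thus "linear_rational (fraction_value (ev U) (ev V))" by (simp add: g_def)
  next
    assume aff: "affine_fps H"
    hence ev: "ev H x = H $ 0 + H $ 1 * x" for x using ev_affine[of H] by (simp add: affine_fps_def)
    have "n = 1" using n' aff by (cases "n \<ge> 2") (auto simp: affine_fps_def)
    hence H1: "H $ 1 \<noteq> 0" using n' by simp
    \<comment> \<open>The coefficients come from \<open>h = b + 1 / (H0 + H1 * x)\<close>, with
      \<open>H0\<close>, \<open>H1\<close> the coefficients of \<open>H\<close>.\<close>
    have "linear_rational h"
      unfolding linear_rational_def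
    proof (rule exI[of _ "b * H $ 1"], rule exI[of _ "b * H $ 0 + 1"], rule exI[of _ "H $ 1"],
        rule exI[of _ "H $ 0"], intro conjI allI)
      show "b * H $ 1 * H $ 0 - (b * H $ 0 + 1) * H $ 1 \<noteq> 0" using H1 by (simp add: algebra_simps)
      show "h x = (if H $ 1 * x + H $ 0 = 0 then None
          else Some ((b * H $ 1 * x + (b * H $ 0 + 1)) / (H $ 1 * x + H $ 0)))" for x
      proof (cases "ev H x = 0")
        case True
        thus ?thesis by (simp add: h_None ev add.commute)
      next
        case False
        have "b + 1 / ev H x = (b * ev H x + 1) / ev H x" using False by (simp add: field_simps)
        thus ?thesis using False by (simp add: h_Some ev algebra_simps)
      qed
    qed
    thus "linear_rational (fraction_value (ev S) (ev T))" by (simp add: h_def)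
  qed
qed

section \<open>Primality away from the special slopes\<close>

lemma prime_outside_special_slopes:
  assumes U: "entire_fps (U::'a fps)" and n: "n \<ge> 2" "U $ n \<noteq> 0" and a: "a \<notin> special_slopes U"
  shows "prime_meromorphic (\<lambda>x. Some (ev U x - a * x))"
proof -
  define F where "F = U - fps_const a * fps_X"
  have F: "entire_fps F" using U by (simp add: F_def)
  have evF: "ev F x = ev U x - a * x" for x using U by (simp add: F_def)
  \<comment> \<open>Subtracting \<open>a * x\<close> changes only the coefficient of index 1, while
    \<open>n \<ge> 2\<close>.\<close>
  have Fn: "F $ n \<noteq> 0" using n by (simp add: F_def fps_X_def)
  have F_nonconst: "F \<noteq> fps_const (F $ 0)"
  proof
    assume "F = fps_const (F $ 0)"
    hence "F $ n = fps_const (F $ 0) $ n" by simp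
    thus False using Fn n by simp
  qed
  have "fraction_value (ev F) (ev 1) = (\<lambda>x. Some (ev F x))"
    by (rule ext) (use fraction_value_Some[OF F entire_fps_1] in simp)
  moreover have "ev 1 \<noteq> (\<lambda>_. 0 :: 'a)" using ev_1 by (metis zero_neq_one)
  ultimately have "meromorphic_Cp (\<lambda>x. Some (ev F x))"
    unfolding meromorphic_Cp_def entire_iff using F entire_fps_1 by metis
  moreover have "linear_rational g \<or> linear_rational h"
    if g: "meromorphic_Cp g" and h: "meromorphic_Cp h" and comp: "is_composition (\<lambda>x. Some (ev F x)) g h" for g h
  proof -
    obtain P Q where PQ: "entire_fps P" "entire_fps Q" "Q \<noteq> 0" "g = fraction_value (ev P) (ev Q)"
      using g unfolding meromorphic_Cp_def entire_iff by (metis ext ev_0)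
    obtain S T where ST: "entire_fps S" "entire_fps T" "T \<noteq> 0" "h = fraction_value (ev S) (ev T)"
      using h unfolding meromorphic_Cp_def entire_iff by (metis ext ev_0)
    have comp: "fraction_value (ev P) (ev Q) y = Some (ev F x)" if "fraction_value (ev S) (ev T) x = Some y" for x y
      using comp that by (simp add: is_composition_def PQ(4) ST(4))
    obtain G H m where GH: "entire_fps G" "entire_fps H" "m > 0" "H $ m \<noteq> 0" "\<And>x. ev F x = ev G (ev H x)"
      "affine_fps G \<Longrightarrow> linear_rational g" "affine_fps H \<Longrightarrow> linear_rational h"
    proof (cases "\<exists>x0. fraction_value (ev S) (ev T) x0 = None")
      case True
      then obtain x0 where x0: "fraction_value (ev S) (ev T) x0 = None" by blast
      show ?thesis
      proof (rule factors_with_pole[OF F F_nonconst ST(1-3) PQ(1-3) _ x0])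
        fix x y assume "fraction_value (ev S) (ev T) x = Some y"
        thus "fraction_value (ev P) (ev Q) y = Some (ev F x)" by (rule comp)
      next
        fix G H n
        assume "entire_fps G" "entire_fps H" "n > 0" "H $ n \<noteq> 0" "\<And>x. ev F x = ev G (ev H x)"
          "affine_fps G \<Longrightarrow> linear_rational (fraction_value (ev P) (ev Q))"
          "affine_fps H \<Longrightarrow> linear_rational (fraction_value (ev S) (ev T))"
        thus ?thesis by (rule that[unfolded PQ(4) ST(4)])
      qed
    next
      case False
      hence np: "fraction_value (ev S) (ev T) x \<noteq> None" for x by simp
      show ?thesis
      proof (rule factors_without_pole[OF F F_nonconst ST(1-3) PQ(1-3) _ np])
        fix x y assume "fraction_value (ev S) (ev T) x = Some y"
        thus "fraction_value (ev P) (ev Q) y = Some (ev F x)" by (rule comp)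
      next
        fix G H n
        assume "entire_fps G" "entire_fps H" "n > 0" "H $ n \<noteq> 0" "\<And>x. ev F x = ev G (ev H x)"
          "affine_fps G \<Longrightarrow> linear_rational (fraction_value (ev P) (ev Q))"
          "affine_fps H \<Longrightarrow> linear_rational (fraction_value (ev S) (ev T))"
        thus ?thesis by (rule that[unfolded PQ(4) ST(4)])
      qed
    qed
    have "affine_fps G \<or> affine_fps H"
      unfolding affine_fps_def
      by (rule entire_composition_affine[OF U GH(1,2) _ a GH(3,4)]) (use GH(5) evF in simp)
    thus ?thesis using GH(6,7) by blast
  qed
  ultimately show ?thesis unfolding prime_meromorphic_def evF by blast
qed

end

lemma padic_abs_prime:
  assumes "prime p"
  shows "padic_abs p (of_nat p) = 1 / real p"
proof -
  have "quotient_of (of_nat p) = (int p, 1)"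
    using quotient_of_int[of "int p"] by simp
  moreover have "multiplicity (int p) (int p) = 1"
    using assms by (intro multiplicity_self) auto
  ultimately show ?thesis
    using assms by (simp add: padic_abs_def power_int_minus field_simps)
qed

theorem theorem2p15:
  fixes p :: nat and f :: "'a::nonarch_field \<Rightarrow> 'a"
  assumes "prime p"
    and "is_Cp p TYPE('a)"
    and "transcendental_entire f"
  shows "countable {a. \<not> prime_meromorphic (\<lambda>x. Some (f x - a * x))}"
proof -
  have abs: "\<And>q. absval (of_rat q :: 'a) = padic_abs p q" and "complete (UNIV :: 'a set)"
    using assms(2) by (auto simp: is_Cp_def)
  obtain L :: "'a set" where L: "is_algebraic_closure (closure (range of_rat)) L" "closure L = UNIV"
    using assms(2) by (auto simp: is_Cp_def)
  interpret dense_alg_closed L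
  proof
    show "complete (UNIV :: 'a set)" by fact
    have "absval (of_nat p :: 'a) = 1 / real p"
      using abs[of "of_nat p"] padic_abs_prime[OF assms(1)] by simp
    thus "\<exists>x::'a. x \<noteq> 0 \<and> absval x < 1"
      using prime_gt_1_nat[OF assms(1)] by (intro exI[of _ "of_nat p"]) auto
  qed (use L in \<open>auto simp: is_algebraic_closure_def\<close>)
  obtain D :: "'a set" where D: "countable D" "closure D = UNIV"
    using countable_dense_subset L(1) unfolding is_algebraic_closure_def by blast
  obtain U where U: "entire_fps U" "f = ev U"
    using assms(3) by (auto simp: transcendental_entire_def entire_iff)
  \<comment> \<open>Transcendence provides a nonzero coefficient of index at least 2; in
    characteristic 0 the second derivative is then nonzero, as
    \<open>countable_special_slopes\<close> requires.\<close>
  obtain n where n: "n \<ge> 2" "U $ n \<noteq> 0"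
  proof (rule ccontr)
    assume "\<not> thesis"
    hence "\<forall>n\<ge>2. U $ n = 0" using that by blast
    hence "f = poly [:U $ 0, U $ 1:]" by (auto simp: U(2) ev_affine mult.commute)
    thus False using assms(3) by (auto simp: transcendental_entire_def)
  qed
  have "fps_deriv (fps_deriv U) $ (n - 2) = of_nat (n - 1) * (of_nat n * U $ n)"
    using n(1) by (simp add: of_nat_diff numeral_2_eq_2 Suc_diff_Suc)
  hence "fps_deriv (fps_deriv U) $ (n - 2) \<noteq> 0" using n by auto
  hence "fps_deriv (fps_deriv U) \<noteq> 0" by (metis fps_zero_nth)
  hence "countable (special_slopes U)" by (rule countable_special_slopes[OF U(1) _ D])
  moreover have "{a. \<not> prime_meromorphic (\<lambda>x. Some (f x - a * x))} \<subseteq> special_slopes U"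
    using prime_outside_special_slopes[OF U(1) n] U(2) by blast
  ultimately show ?thesis by (rule countable_subset[rotated])
qed

end
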